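(* Let $u\in LC^q(\Omega^+,\Omega^-)$ have jumps $[\partial_{\mathbf n}^i u]=g^i$ across $\Gamma$ with $g^i\in LC^{q-i}(\Gamma)$ for $0\le i\le q$. Let $D$ be a linear differential operator and $D^h_{p,q}$ a linear finite difference discretization of $D$ on a Cartesian grid of spacing $h$ such that $$(Dw)(\mathbf x_{i,j})=(D^h_{p,q}w)_{i,j}+\mathcal O(h^p)$$ whenever $w\in LC^q(U)$ for some convex open set $U$ containing the stencil of $(D^h_{p,q}w)_{i,j}$. Let $\Gamma_\epsilon$, with $\epsilon=\mathcal O(h)$, be the band around $\Gamma$ described in the context. If $v\in LC^q(\Gamma_\epsilon)$ satisfies $$\partial_{\mathbf n}^i v|_\Gamma=g^i\qquad\text{for } 0\le i\le q,$$ then $$Du=D^h_{p,q}u-D^h_{p,q}\bigl(v\,H(\phi)\bigr)+\bigl(D^h_{p,q}v\bigr)H(\phi)+\mathcal O(h^p)$$ at all grid points in $\Omega$; that is, the right-hand side without the error term is a $p$th order accurate approximation of $Du$ in all of $\Omega$.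
   Context: Setting: $\Omega\subset\mathbb R^d$ is a domain and $\Gamma\subset\Omega$ is a smooth, closed, codimension-one interface. $\Omega^+$ and $\Omega^-$ are the parts of $\Omega$ interior and exterior to the region bounded by $\Gamma$, and $\phi$ is the signed distance function to $\Gamma$, positive in $\Omega^+$ and negative in $\Omega^-$. $\mathbf n=\nabla\phi$ is the (inward) unit normal, defined near $\Gamma$; $\partial_{\mathbf n}u=\nabla u\cdot\mathbf n$, and $\partial_{\mathbf n}^i$ is its $i$-fold iterate ($\partial_{\mathbf n}^0 u=u$). For $\mathbf x\in\Gamma$, $u^\pm(\mathbf x)=\lim_{s\to0^+}u(\mathbf x\pm s\mathbf n)$ and $[u]=u^+-u^-$. $H(z)=1$ if $z\ge0$ and $H(z)=0$ if $z<0$. By convention $u$ and its derivatives take on $\Gamma$ their $+$ values: $u|_\Gamma=u^+$, and likewise for derivatives of $u$. Function spaces: for open $U\subset\mathbb R^d$, $LC^k(U)$ is the space of functions on $U$ whose derivatives of all orders $0,\dots,k$ exist and are Lipschitz on $U$ (with respect to Euclidean distance). $LC^k(U_1,U_2)$ is the space of functions on $U_1\cup U_2$ whose restrictions to $U_1$ and to $U_2$ lie in $LC^k(U_1)$ and $LC^k(U_2)$ respectively. $LC^k(\Gamma)$ is the space of functions on $\Gamma$ that extend to a function in $LC^k(U)$ for some open $U\supset\Gamma$. Grid: the grid points are written $\mathbf x_{i,j}=(ih,jh)$ in two-dimensional notation; the analogous notation is used in other dimensions. Grid points under consideration are those whose stencil has convex hull contained in $\Omega$. The stencil at a grid point has diameter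 $\mathcal O(h)$; it is said to cross the interface if its convex hull meets $\Gamma$. Band: $\Gamma_\epsilon=\{\mathbf x\in\Omega:|\phi(\mathbf x)|<\epsilon\}$, with $\epsilon=\mathcal O(h)$ chosen so that no stencil evaluated at a grid point of $\Omega\setminus\Gamma_\epsilon$ crosses the interface, and so that the convex hull of any stencil that does cross the interface is contained in $\Gamma_\epsilon$; $h$ is sufficiently small that $\phi$ is smooth on $\Gamma_\epsilon$. At grid points whose stencil does not cross the interface, the terms $-D^h_{p,q}(vH(\phi))+(D^h_{p,q}v)H(\phi)$ cancel and are read as $0$ (even though $v$ is only defined on $\Gamma_\epsilon$). Meaning of $\mathcal O$: in both the hypothesis on $D^h_{p,q}$ and the conclusion, the constant in $\mathcal O(h^p)$ is independent of $h$ and of the grid point, and depends on the functions involved ($w$ in the hypothesis; $u,v$ in the conclusion) only through the Lipschitz constants of their derivatives of orders $0,\dots,q$. *)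

theory Defs
  imports "HOL-Analysis.Analysis" "HOL-Library.Landau_Symbols"
begin

section \<open>Derivatives and Lipschitz spaces\<close>

definition partial :: "'d::finite \<Rightarrow> (real^'d \<Rightarrow> real) \<Rightarrow> real^'d \<Rightarrow> real" where
  "partial i f x = frechet_derivative f (at x) (axis i 1)"

fun partials :: "'d::finite list \<Rightarrow> (real^'d \<Rightarrow> real) \<Rightarrow> real^'d \<Rightarrow> real" where
  "partials [] f = f"
| "partials (i # is) f = partial i (partials is f)"

definition grad :: "(real^'d::finite \<Rightarrow> real) \<Rightarrow> real^'d \<Rightarrow> real^'d" where
  "grad f x = (\<chi> i. partial i f x)"

definition smooth_on :: "(real^'d::finite) set \<Rightarrow> (real^'d \<Rightarrow> real) \<Rightarrow> bool" where
  "smooth_on U f \<longleftrightarrow> (\<forall>is. \<forall>x\<in>U. partials is f differentiable (at x))"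

text \<open>\<open>U\<close> is meant to be open. On \<open>U\<close> all derivatives of \<open>f\<close> of orders \<open>0, \<dots>, k\<close> exist, and those
  of order \<open>i\<close> are Lipschitz with constant \<open>\<Lambda> i\<close>. The explicit \<open>\<Lambda>\<close> is needed to say
  that an error constant depends on a function only through these Lipschitz constants.\<close>

definition LC_with :: "nat \<Rightarrow> (nat \<Rightarrow> real) \<Rightarrow> (real^'d::finite) set \<Rightarrow> (real^'d \<Rightarrow> real) \<Rightarrow> bool" where
  "LC_with k \<Lambda> U f \<longleftrightarrow>
     (\<forall>is. length is < k \<longrightarrow> (\<forall>x\<in>U. partials is f differentiable (at x))) \<and>
     (\<forall>is. length is \<le> k \<longrightarrow> (\<Lambda> (length is))-lipschitz_on U (partials is f))"

definition LC :: "nat \<Rightarrow> (real^'d::finite) set \<Rightarrow> (real^'d \<Rightarrow> real) set" where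
  "LC k U = {f. \<exists>\<Lambda>. LC_with k \<Lambda> U f}"

definition LC2 :: "nat \<Rightarrow> (real^'d::finite) set \<Rightarrow> (real^'d) set \<Rightarrow> (real^'d \<Rightarrow> real) set" where
  "LC2 k U1 U2 = LC k U1 \<inter> LC k U2"

definition LC_surface :: "nat \<Rightarrow> (real^'d::finite) set \<Rightarrow> (real^'d \<Rightarrow> real) set" where
  "LC_surface k \<Gamma> = {g. \<exists>U. open U \<and> \<Gamma> \<subseteq> U \<and> (\<exists>G\<in>LC k U. \<forall>x\<in>\<Gamma>. G x = g x)}"

section \<open>The interface\<close>

definition smooth_closed_hypersurface :: "(real^'d::finite) set \<Rightarrow> bool" where
  "smooth_closed_hypersurface \<Gamma> \<longleftrightarrow> compact \<Gamma> \<and> \<Gamma> \<noteq> {} \<and>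
     (\<forall>x\<in>\<Gamma>. \<exists>N \<psi>. open N \<and> x \<in> N \<and> smooth_on N \<psi> \<and> grad \<psi> x \<noteq> 0 \<and>
        \<Gamma> \<inter> N = {y\<in>N. \<psi> y = 0})"

text \<open>\<open>R\<close> is the region bounded by \<open>\<Gamma>\<close>. The regularity condition \<open>interior (closure R) = R\<close>
  excludes a component of \<open>\<Gamma>\<close> having \<open>R\<close> on both of its sides.\<close>

definition bounds_region :: "(real^'d::finite) set \<Rightarrow> (real^'d) set \<Rightarrow> bool" where
  "bounds_region \<Gamma> R \<longleftrightarrow> open R \<and> bounded R \<and> frontier R = \<Gamma> \<and> interior (closure R) = R"

definition inner_part :: "(real^'d::finite) set \<Rightarrow> (real^'d) set \<Rightarrow> (real^'d) set" where
  "inner_part \<Omega> R = \<Omega> \<inter> R"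

definition outer_part :: "(real^'d::finite) set \<Rightarrow> (real^'d) set \<Rightarrow> (real^'d) set" where
  "outer_part \<Omega> R = \<Omega> - closure R"

definition signed_dist :: "(real^'d::finite) set \<Rightarrow> (real^'d) set \<Rightarrow> real^'d \<Rightarrow> real" where
  "signed_dist \<Gamma> R x = (if x \<in> R then infdist x \<Gamma> else - infdist x \<Gamma>)"

definition heaviside :: "real \<Rightarrow> real" where
  "heaviside z = (if z \<ge> 0 then 1 else 0)"

definition band :: "(real^'d::finite) set \<Rightarrow> (real^'d \<Rightarrow> real) \<Rightarrow> real \<Rightarrow> (real^'d) set" where
  "band \<Omega> \<phi> \<epsilon> = {x\<in>\<Omega>. \<bar>\<phi> x\<bar> < \<epsilon>}"

section \<open>Normal derivatives, one-sided values and jumps\<close>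

text \<open>The unit normal is \<open>grad \<phi>\<close>.\<close>

definition normal_deriv :: "(real^'d::finite \<Rightarrow> real) \<Rightarrow> (real^'d \<Rightarrow> real) \<Rightarrow> real^'d \<Rightarrow> real" where
  "normal_deriv \<phi> f x = grad f x \<bullet> grad \<phi> x"

definition plus_value :: "(real^'d::finite \<Rightarrow> real) \<Rightarrow> (real^'d \<Rightarrow> real) \<Rightarrow> real^'d \<Rightarrow> real" where
  "plus_value \<phi> f x = Lim (at_right 0) (\<lambda>s. f (x + s *\<^sub>R grad \<phi> x))"

definition minus_value :: "(real^'d::finite \<Rightarrow> real) \<Rightarrow> (real^'d \<Rightarrow> real) \<Rightarrow> real^'d \<Rightarrow> real" where
  "minus_value \<phi> f x = Lim (at_right 0) (\<lambda>s. f (x - s *\<^sub>R grad \<phi> x))"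

definition jump :: "(real^'d::finite \<Rightarrow> real) \<Rightarrow> (real^'d \<Rightarrow> real) \<Rightarrow> real^'d \<Rightarrow> real" where
  "jump \<phi> f x = plus_value \<phi> f x - minus_value \<phi> f x"

text \<open>The convention that a function given off \<open>\<Gamma>\<close> takes its plus values on \<open>\<Gamma>\<close>. For a
  derivative of \<open>u\<close>, differentiate first and extend to \<open>\<Gamma>\<close> afterwards.\<close>

definition plus_ext ::
  "(real^'d::finite) set \<Rightarrow> (real^'d \<Rightarrow> real) \<Rightarrow> (real^'d \<Rightarrow> real) \<Rightarrow> real^'d \<Rightarrow> real" where
  "plus_ext \<Gamma> \<phi> f x = (if x \<in> \<Gamma> then plus_value \<phi> f x else f x)"

section \<open>Differential operators and finite differences\<close>

text \<open>The linear operator of order at most \<open>m\<close> with coefficient functions \<open>a\<close>, indexed by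
  lists of coordinate directions. Its argument is the family \<open>F\<close> of derivatives
  (\<open>F is\<close> in place of \<open>partials is w\<close>), so that it can also be evaluated on the one-sided
  derivatives of a function that jumps.\<close>

definition diff_op ::
  "nat \<Rightarrow> ('d::finite list \<Rightarrow> real^'d \<Rightarrow> real) \<Rightarrow> ('d list \<Rightarrow> real^'d \<Rightarrow> real) \<Rightarrow> real^'d \<Rightarrow> real" where
  "diff_op m a F x = (\<Sum>is | length is \<le> m. a is x * F is x)"

definition grid_point :: "real \<Rightarrow> int^'d::finite \<Rightarrow> real^'d" where
  "grid_point h j = (\<chi> i. h * of_int (j $ i))"

text \<open>\<open>S h j\<close> is the set of (absolute) grid indices used by the difference formula at \<open>j\<close>, and
  \<open>c h j k\<close> is the weight of the value at the grid point with index \<open>k\<close>.\<close>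

definition stencil :: "(real \<Rightarrow> int^'d::finite \<Rightarrow> (int^'d) set) \<Rightarrow> real \<Rightarrow> int^'d \<Rightarrow> (real^'d) set" where
  "stencil S h j = grid_point h ` S h j"

definition fd_op ::
  "(real \<Rightarrow> int^'d::finite \<Rightarrow> (int^'d) set) \<Rightarrow> (real \<Rightarrow> int^'d \<Rightarrow> int^'d \<Rightarrow> real) \<Rightarrow>
     real \<Rightarrow> (real^'d \<Rightarrow> real) \<Rightarrow> int^'d \<Rightarrow> real" where
  "fd_op S c h w j = (\<Sum>k\<in>S h j. c h j k * w (grid_point h k))"

definition grid ::
  "(real^'d::finite) set \<Rightarrow> (real \<Rightarrow> int^'d \<Rightarrow> (int^'d) set) \<Rightarrow> real \<Rightarrow> (int^'d) set" where
  "grid \<Omega> S h = {j. grid_point h j \<in> \<Omega> \<and> convex hull (stencil S h j) \<subseteq> \<Omega>}"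

text \<open>The grid point has to lie in every convex open set containing the stencil for the
  consistency condition below to make sense, i.e. it lies in the convex hull of the stencil.\<close>

definition fd_stencils ::
  "(real^'d::finite) set \<Rightarrow> (real \<Rightarrow> int^'d \<Rightarrow> (int^'d) set) \<Rightarrow> real \<Rightarrow> bool" where
  "fd_stencils \<Omega> S h0 \<longleftrightarrow>
     (\<forall>h\<in>{0<..<h0}. \<forall>j\<in>grid \<Omega> S h.
        finite (S h j) \<and> grid_point h j \<in> convex hull (stencil S h j)) \<and>
     (\<exists>M. \<forall>h\<in>{0<..<h0}. \<forall>j\<in>grid \<Omega> S h. diameter (stencil S h j) \<le> M * h)"

definition consistent ::
  "nat \<Rightarrow> nat \<Rightarrow> (real^'d::finite) set \<Rightarrow> nat \<Rightarrow> ('d list \<Rightarrow> real^'d \<Rightarrow> real) \<Rightarrow>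
     (real \<Rightarrow> int^'d \<Rightarrow> (int^'d) set) \<Rightarrow> (real \<Rightarrow> int^'d \<Rightarrow> int^'d \<Rightarrow> real) \<Rightarrow> real \<Rightarrow> bool" where
  "consistent p q \<Omega> m a S c h0 \<longleftrightarrow>
     (\<forall>\<Lambda>. \<exists>C. \<forall>h\<in>{0<..<h0}. \<forall>j\<in>grid \<Omega> S h. \<forall>U w.
        open U \<and> convex U \<and> stencil S h j \<subseteq> U \<and> LC_with q \<Lambda> U w \<longrightarrow>
        \<bar>diff_op m a (\<lambda>is. partials is w) (grid_point h j) - fd_op S c h w j\<bar> \<le> C * h ^ p)"

definition crosses ::
  "(real^'d::finite) set \<Rightarrow> (real \<Rightarrow> int^'d \<Rightarrow> (int^'d) set) \<Rightarrow> real \<Rightarrow> int^'d \<Rightarrow> bool" where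
  "crosses \<Gamma> S h j \<longleftrightarrow> convex hull (stencil S h j) \<inter> \<Gamma> \<noteq> {}"

definition admissible_band ::
  "(real^'d::finite) set \<Rightarrow> (real^'d) set \<Rightarrow> (real^'d \<Rightarrow> real) \<Rightarrow>
     (real \<Rightarrow> int^'d \<Rightarrow> (int^'d) set) \<Rightarrow> real \<Rightarrow> real \<Rightarrow> bool" where
  "admissible_band \<Omega> \<Gamma> \<phi> S h \<epsilon> \<longleftrightarrow> \<epsilon> > 0 \<and> smooth_on (band \<Omega> \<phi> \<epsilon>) \<phi> \<and>
     (\<forall>j\<in>grid \<Omega> S h. grid_point h j \<notin> band \<Omega> \<phi> \<epsilon> \<longrightarrow> \<not> crosses \<Gamma> S h j) \<and>
     (\<forall>j\<in>grid \<Omega> S h. crosses \<Gamma> S h j \<longrightarrow> convex hull (stencil S h j) \<subseteq> band \<Omega> \<phi> \<epsilon>)"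

text \<open>The correction \<open>- D\<^sup>h(v H(\<phi>)) + (D\<^sup>h v) H(\<phi>)\<close>, read as \<open>0\<close> where the stencil does not
  cross the interface.\<close>

definition correction ::
  "(real^'d::finite) set \<Rightarrow> (real^'d \<Rightarrow> real) \<Rightarrow> (real \<Rightarrow> int^'d \<Rightarrow> (int^'d) set) \<Rightarrow>
     (real \<Rightarrow> int^'d \<Rightarrow> int^'d \<Rightarrow> real) \<Rightarrow> real \<Rightarrow> (real^'d \<Rightarrow> real) \<Rightarrow> int^'d \<Rightarrow> real" where
  "correction \<Gamma> \<phi> S c h v j =
     (if crosses \<Gamma> S h j
      then - fd_op S c h (\<lambda>x. v x * heaviside (\<phi> x)) j
           + fd_op S c h v j * heaviside (\<phi> (grid_point h j))
      else 0)"

end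

theory Submission
  imports Defs
begin

text \<open>Where the stencil does not cross \<open>\<Gamma>\<close>, its convex hull has a convex neighbourhood on one side of
  \<open>\<Gamma>\<close>, and consistency applies to \<open>u\<close> itself. Where it does cross, linearity gives
  \<open>D\<^sup>h u - D\<^sup>h(v H(\<phi>)) + (D\<^sup>h v) H(\<phi>) = D\<^sup>h w\<close> for \<open>\<phi> < 0\<close> and \<open>= D\<^sup>h (w + v)\<close> for \<open>\<phi> \<ge> 0\<close> at the
  grid point, where \<open>w = u - v H(\<phi>)\<close>; and there the derivatives of \<open>w\<close>, respectively \<open>w + v\<close>, are those
  of \<open>u\<close>, with plus values on \<open>\<Gamma>\<close>. So it suffices that \<open>w\<close> is of class \<open>LC\<^sup>q\<close> on a convex neighbourhood of the hull
  inside the band, with Lipschitz constants \<open>\<Lambda>u + \<Lambda>v\<close> (lemma \<open>jump_removal\<close>); consistency then applies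
  to \<open>w\<close> and to \<open>w + v\<close>.

  All partial derivatives of \<open>w\<close> of order at most \<open>q\<close> are Lipschitz on each side and hence
  extend continuously to \<open>\<Gamma>\<close>. That the two extensions agree (lemma \<open>traces_agree\<close>) is
  proved by induction on the order \<open>k\<close>. If the jumps of order \<open>k - 1\<close> vanish along \<open>\<Gamma>\<close>, so do their
  tangential derivatives; by symmetry of mixed derivatives the jump of order \<open>k\<close> is then
  \<open>\<mu> n\<^bsub>i(1)\<^esub> \<cdots> n\<^bsub>i(k)\<^esub>\<close> with a scalar \<open>\<mu>\<close> and
  \<open>n = \<nabla>\<phi>\<close>. The \<open>k\<close>-th normal derivative is the contraction of the derivatives
  of order \<open>k\<close> with \<open>n \<otimes> \<cdots> \<otimes> n\<close> plus a combination of lower ones with smooth coefficients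
  (lemma \<open>normal_deriv_expansion\<close>), and that of \<open>w\<close> does not jump, so \<open>\<mu> = 0\<close>.

  Differentiability of the glued function at a point of \<open>\<Gamma>\<close>, and of the traces along \<open>\<Gamma>\<close>, both rest on
  lemma \<open>one_sided_has_derivative\<close>: a function that is continuous up to the
  boundary of \<open>{\<phi> > 0}\<close>, and whose gradient is continuous up to the boundary, is differentiable at boundary
  points relative to \<open>{\<phi> \<ge> 0}\<close>. Finally, \<open>\<nabla>\<phi> \<noteq> 0\<close> on \<open>\<Gamma>\<close>, as \<open>\<phi>\<close> decreases at unit rate towards a nearest
  point of \<open>\<Gamma>\<close>.\<close>

section \<open>Derivatives at boundary points and mixed derivatives\<close>

lemma line_mvt:
  fixes f :: "'a::real_normed_vector \<Rightarrow> real"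
  assumes cont: "continuous_on ((\<lambda>t. p + t *\<^sub>R w) ` {0..1}) f"
    and der: "\<And>t. 0 < t \<Longrightarrow> t < 1 \<Longrightarrow> (f has_derivative D t) (at (p + t *\<^sub>R w))"
  obtains t where "0 < t" "t < 1" "f (p + w) - f p = D t w"
proof -
  have c: "continuous_on {0..1} (\<lambda>t. f (p + t *\<^sub>R w))"
    using continuous_on_compose[of _ "\<lambda>t. p + t *\<^sub>R w", OF _ cont]
    by (simp add: o_def continuous_intros)
  have d: "((\<lambda>t. f (p + t *\<^sub>R w)) has_derivative (\<lambda>h. D t (h *\<^sub>R w))) (at t)"
    if "0 < t" "t < 1" for t :: real
  proof -
    have "((\<lambda>t. p + t *\<^sub>R w) has_derivative (\<lambda>h. h *\<^sub>R w)) (at t)"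
      by (auto intro!: derivative_eq_intros)
    from has_derivative_compose[OF this der[OF that]] show ?thesis .
  qed
  obtain t where "0 < t" "t < 1"
    "f (p + 1 *\<^sub>R w) - f (p + 0 *\<^sub>R w) = D t ((1 - 0) *\<^sub>R w)"
    using mvt[OF zero_less_one c d] by blast
  then show thesis using that by simp
qed

text \<open>The estimate behind Young's theorem: only differentiability of \<open>f\<close> near \<open>x\<close> and of one directional
  derivative at \<open>x\<close> is needed.\<close>

lemma second_difference_estimate:
  fixes f :: "'a::real_normed_vector \<Rightarrow> real"
  assumes "open A" "x \<in> A"
    and f': "\<And>y. y \<in> A \<Longrightarrow> (f has_derivative f' y) (at y)"
    and f'': "((\<lambda>y. f' y a) has_derivative Da) (at x)"
  shows "((\<lambda>t. (f (x + t *\<^sub>R a + t *\<^sub>R b) - f (x + t *\<^sub>R a) - f (x + t *\<^sub>R b) + f x) / t\<^sup>2)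
    \<longlongrightarrow> Da b) (at_right 0)"
proof -
  obtain r where r: "r > 0" "ball x r \<subseteq> A"
    using assms(1,2) open_contains_ball by blast
  have lDa: "linear Da" using f'' has_derivative_bounded_linear bounded_linear.linear by blast
  define K where "K = 2 * norm a + norm b + 1"
  have K: "K > 0" by (simp add: K_def add_nonneg_pos)
  show ?thesis
  proof (rule tendstoI)
    fix e :: real assume "e > 0"
    define e' where "e' = e / (3 * K)"
    have "e' > 0" using \<open>e > 0\<close> K by (simp add: e'_def)
    then obtain d where d: "d > 0"
      "\<And>y. norm (y - x) < d \<Longrightarrow> \<bar>f' y a - f' x a - Da (y - x)\<bar> \<le> e' * norm (y - x)"
      using f'' unfolding has_derivative_at_alt by (metis real_norm_def)
    define t0 where "t0 = min r d / K"
    have t0: "t0 > 0" using r(1) d(1) K by (simp add: t0_def)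
    have "dist ((f (x + t *\<^sub>R a + t *\<^sub>R b) - f (x + t *\<^sub>R a) - f (x + t *\<^sub>R b) + f x) / t\<^sup>2)
        (Da b) < e" if t: "0 < t" "t < t0" for t
    proof -
      have small: "t * K < r" "t * K < d"
        using t(2) K by (simp_all add: t0_def pos_less_divide_eq)
      have near: "norm (s *\<^sub>R t *\<^sub>R a + \<tau> *\<^sub>R b) \<le> t * K"
        if "0 \<le> s" "s \<le> 1" "\<tau> = 0 \<or> \<tau> = t" for s \<tau>
      proof -
        have "norm (s *\<^sub>R t *\<^sub>R a) \<le> t * norm a"
          using that t by (simp add: abs_mult mult_left_le_one_le mult_right_mono)
        moreover have "norm (\<tau> *\<^sub>R b) \<le> t * norm b" using that t by auto
        ultimately have "norm (s *\<^sub>R t *\<^sub>R a + \<tau> *\<^sub>R b) \<le> t * norm a + t * norm b"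
          by (rule norm_triangle_le[OF add_mono])
        also have "\<dots> \<le> t * K" using t by (simp add: K_def algebra_simps)
        finally show ?thesis .
      qed
      have inA: "x + \<tau> *\<^sub>R b + s *\<^sub>R t *\<^sub>R a \<in> A" if "0 \<le> s" "s \<le> 1" "\<tau> = 0 \<or> \<tau> = t" for s \<tau>
      proof -
        have "dist x (x + \<tau> *\<^sub>R b + s *\<^sub>R t *\<^sub>R a) = norm (s *\<^sub>R t *\<^sub>R a + \<tau> *\<^sub>R b)"
          unfolding dist_commute[of x] unfolding dist_norm by (simp add: algebra_simps)
        also have "\<dots> < r" using near[OF that] small by linarith
        finally show ?thesis using r(2) by (auto simp: subset_iff)
      qed
      \<comment> \<open>The second difference is the increment, along \<open>t *\<^sub>R a\<close>, of the first difference in the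
         direction \<open>b\<close>.\<close>
      define g where "g = (\<lambda>y. f (y + t *\<^sub>R b) - f y)"
      have g': "(g has_derivative (\<lambda>h. f' (x + s *\<^sub>R t *\<^sub>R a + t *\<^sub>R b) h - f' (x + s *\<^sub>R t *\<^sub>R a) h))
          (at (x + s *\<^sub>R t *\<^sub>R a))" if "0 \<le> s" "s \<le> 1" for s
        unfolding g_def
      proof (rule has_derivative_diff)
        have shift: "((\<lambda>y. y + t *\<^sub>R b) has_derivative (\<lambda>h. h)) (at (x + s *\<^sub>R t *\<^sub>R a))"
          by (auto intro!: derivative_eq_intros)
        have "x + s *\<^sub>R t *\<^sub>R a + t *\<^sub>R b \<in> A" using inA[OF that, of t] by (simp add: ac_simps)
        from has_derivative_compose[OF shift f'[OF this]]
        show "((\<lambda>y. f (y + t *\<^sub>R b)) has_derivative f' (x + s *\<^sub>R t *\<^sub>R a + t *\<^sub>R b))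
          (at (x + s *\<^sub>R t *\<^sub>R a))" .
        show "(f has_derivative f' (x + s *\<^sub>R t *\<^sub>R a)) (at (x + s *\<^sub>R t *\<^sub>R a))"
          using f' inA[OF that, of 0] by simp
      qed
      have cg: "continuous_on ((\<lambda>s. x + s *\<^sub>R (t *\<^sub>R a)) ` {0..1}) g"
        by (rule has_derivative_continuous_on, rule has_derivative_at_withinI)
          (use g' in force)
      obtain s where s: "0 < s" "s < 1" and eq: "g (x + t *\<^sub>R a) - g x
          = f' (x + s *\<^sub>R t *\<^sub>R a + t *\<^sub>R b) (t *\<^sub>R a) - f' (x + s *\<^sub>R t *\<^sub>R a) (t *\<^sub>R a)"
        using line_mvt[OF cg g'] by (metis less_imp_le)
      have lin: "linear (f' y)" if "y \<in> A" for y
        using f'[OF that] has_derivative_bounded_linear bounded_linear.linear by blast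
      define y1 where "y1 = x + s *\<^sub>R t *\<^sub>R a + t *\<^sub>R b"
      define y0 where "y0 = x + s *\<^sub>R t *\<^sub>R a"
      have yA: "y1 \<in> A" "y0 \<in> A"
        using inA[of s t] inA[of s 0] s by (simp_all add: y0_def y1_def ac_simps)
      have eq2: "g (x + t *\<^sub>R a) - g x = t * (f' y1 a - f' y0 a)"
        using eq unfolding y1_def[symmetric] unfolding y0_def[symmetric] linear_cmul[OF lin[OF yA(1)]]
          linear_cmul[OF lin[OF yA(2)]] by (simp add: right_diff_distrib)
      have n1: "norm (y1 - x) \<le> t * K" and n0: "norm (y0 - x) \<le> t * K"
        using near[of s t] near[of s 0] s by (simp_all add: y0_def y1_def add.assoc)
      have "\<bar>f' y1 a - f' x a - Da (y1 - x)\<bar> \<le> e' * (t * K)"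
        using d(2)[of y1] n1 small(2) \<open>e' > 0\<close>
        by (smt (verit) mult_left_mono)
      moreover have "\<bar>f' y0 a - f' x a - Da (y0 - x)\<bar> \<le> e' * (t * K)"
        using d(2)[of y0] n0 small(2) \<open>e' > 0\<close>
        by (smt (verit) mult_left_mono)
      moreover have "Da (y1 - x) - Da (y0 - x) = t * Da b"
        using linear_add[OF lDa, of "y0 - x" "t *\<^sub>R b"] linear_cmul[OF lDa, of t b]
        by (simp add: y1_def y0_def algebra_simps)
      ultimately have "\<bar>f' y1 a - f' y0 a - t * Da b\<bar> \<le> 2 * (e' * (t * K))" by linarith
      also have "\<dots> < t * e" using K t \<open>e > 0\<close> by (simp add: e'_def field_simps)
      finally have main: "\<bar>f' y1 a - f' y0 a - t * Da b\<bar> < t * e" .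
      have "(f (x + t *\<^sub>R a + t *\<^sub>R b) - f (x + t *\<^sub>R a) - f (x + t *\<^sub>R b) + f x) / t\<^sup>2
          = (g (x + t *\<^sub>R a) - g x) / t\<^sup>2" by (simp add: g_def algebra_simps)
      also have "\<dots> = (f' y1 a - f' y0 a) / t"
        using t by (simp add: eq2 power2_eq_square)
      finally have quot: "(f (x + t *\<^sub>R a + t *\<^sub>R b) - f (x + t *\<^sub>R a) - f (x + t *\<^sub>R b) + f x) / t\<^sup>2
          = (f' y1 a - f' y0 a) / t" .
      have "dist ((f (x + t *\<^sub>R a + t *\<^sub>R b) - f (x + t *\<^sub>R a) - f (x + t *\<^sub>R b) + f x) / t\<^sup>2)
          (Da b) = \<bar>(f' y1 a - f' y0 a - t * Da b) / t\<bar>"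
        unfolding quot dist_real_def using t by (simp add: diff_divide_distrib)
      also have "\<dots> < e" using main t by (simp add: abs_divide pos_divide_less_eq mult.commute)
      finally show ?thesis .
    qed
    then show "\<forall>\<^sub>F t in at_right 0.
      dist ((f (x + t *\<^sub>R a + t *\<^sub>R b) - f (x + t *\<^sub>R a) - f (x + t *\<^sub>R b) + f x) / t\<^sup>2) (Da b) < e"
      unfolding eventually_at_right_field using t0 by blast
  qed
qed

lemma second_derivative_symmetric:
  fixes f :: "'a::real_normed_vector \<Rightarrow> real"
  assumes "open A" "x \<in> A"
    and "\<And>y. y \<in> A \<Longrightarrow> (f has_derivative f' y) (at y)"
    and "((\<lambda>y. f' y a) has_derivative Da) (at x)"
    and "((\<lambda>y. f' y b) has_derivative Db) (at x)"
  shows "Da b = Db a"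
proof -
  have "((\<lambda>t. (f (x + t *\<^sub>R a + t *\<^sub>R b) - f (x + t *\<^sub>R a) - f (x + t *\<^sub>R b) + f x) / t\<^sup>2)
      \<longlongrightarrow> Da b) (at_right 0)"
    by (rule second_difference_estimate[OF assms(1-4)])
  moreover have "((\<lambda>t. (f (x + t *\<^sub>R a + t *\<^sub>R b) - f (x + t *\<^sub>R a) - f (x + t *\<^sub>R b) + f x) / t\<^sup>2)
      \<longlongrightarrow> Db a) (at_right 0)"
    using second_difference_estimate[OF assms(1-3,5), of a] by (simp add: algebra_simps)
  ultimately show ?thesis
    using tendsto_unique trivial_limit_at_right_real by blast
qed

text \<open>Near a regular point \<open>x\<close> of \<open>{\<phi> = 0}\<close>, any \<open>y\<close> with \<open>\<phi> y \<ge> 0\<close> is joined to \<open>x\<close> by three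
  segments of total length \<open>O(\<bar>y - x\<bar>)\<close> whose relative interiors lie in \<open>{\<phi> > 0}\<close>: up from \<open>x\<close> in the normal
  direction, across, and down to \<open>y\<close>. The mean value theorem on each bounds the increment
  of \<open>E z = f z - G x \<bullet> z\<close>.\<close>

lemma one_sided_has_derivative:
  fixes f \<phi> :: "'a::real_inner \<Rightarrow> real"
  assumes "open B" "x \<in> B"
    and \<phi>': "\<And>y. y \<in> B \<Longrightarrow> (\<phi> has_derivative (\<lambda>h. N y \<bullet> h)) (at y)"
    and N: "isCont N x" "N x \<noteq> 0" and "\<phi> x = 0"
    and f: "continuous_on {y\<in>B. \<phi> y \<ge> 0} f"
    and f': "\<And>y. y \<in> B \<Longrightarrow> \<phi> y > 0 \<Longrightarrow> (f has_derivative (\<lambda>h. G y \<bullet> h)) (at y)"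
    and G: "continuous (at x within {y\<in>B. \<phi> y \<ge> 0}) G"
  shows "(f has_derivative (\<lambda>h. G x \<bullet> h)) (at x within {y\<in>B. \<phi> y \<ge> 0})"
proof -
  define S where "S = {y\<in>B. \<phi> y \<ge> 0}"
  define n where "n = N x"
  define \<kappa> where "\<kappa> = (norm n)\<^sup>2 / 2"
  define M where "M = 2 * norm n"
  define C where "C = (M + 1) / \<kappa>"
  have pos: "norm n > 0" "\<kappa> > 0" "M > 0" "C > 0"
    using N(2) by (auto simp: n_def \<kappa>_def M_def C_def intro!: divide_pos_pos add_pos_pos)
  obtain r1 where r1: "r1 > 0" "ball x r1 \<subseteq> B"
    using assms(1,2) open_contains_ball by blast
  obtain r2 where r2: "r2 > 0" "\<And>z. dist z x < r2 \<Longrightarrow> dist (N z) n < norm n / 2"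
    using N(1) pos(1) unfolding continuous_at_eps_delta n_def by (metis half_gt_zero)
  define r where "r = min r1 r2"
  have r: "r > 0" "\<And>z. dist z x < r \<Longrightarrow> z \<in> B" "\<And>z. dist z x < r \<Longrightarrow> norm (N z - n) < norm n / 2"
    using r1 r2 by (auto simp: r_def dist_commute dist_norm subset_iff) (metis norm_minus_commute)+
  have Nn: "N z \<bullet> n \<ge> \<kappa>" "norm (N z) \<le> M" if "dist z x < r" for z
  proof -
    have *: "norm (N z - n) < norm n / 2" using r(3) that .
    have "N z \<bullet> n = (norm n)\<^sup>2 + (N z - n) \<bullet> n"
      by (simp add: inner_diff_left power2_norm_eq_inner)
    moreover have "\<bar>(N z - n) \<bullet> n\<bar> \<le> norm (N z - n) * norm n" by (rule Cauchy_Schwarz_ineq2)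
    moreover have "norm (N z - n) * norm n \<le> norm n / 2 * norm n"
      using * by (intro mult_right_mono) auto
    ultimately show "N z \<bullet> n \<ge> \<kappa>" by (simp add: \<kappa>_def power2_eq_square)
    have "norm (N z) \<le> norm (N z - n) + norm n" by norm
    with * show "norm (N z) \<le> M" using pos(1) unfolding M_def by linarith
  qed
  \<comment> \<open>Balls being convex, the mean value theorem applies to \<open>\<phi>\<close> between any two points near \<open>x\<close>.\<close>
  have \<phi>_mvt: "\<exists>z. dist z x < r \<and> \<phi> (p + w) - \<phi> p = N z \<bullet> w"
    if "dist p x < r" "dist (p + w) x < r" for p w
  proof -
    have in_ball: "dist (p + t *\<^sub>R w) x < r" if "0 \<le> t" "t \<le> 1" for t
    proof -
      have "p \<in> ball x r" "p + w \<in> ball x r"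
        using \<open>dist p x < r\<close> \<open>dist (p + w) x < r\<close> by (auto simp: dist_commute)
      then have "(1 - t) *\<^sub>R p + t *\<^sub>R (p + w) \<in> ball x r"
        using that by (intro convexD_alt[OF convex_ball]) auto
      then show ?thesis by (simp add: algebra_simps dist_commute)
    qed
    have "continuous_on ((\<lambda>t. p + t *\<^sub>R w) ` {0..1}) \<phi>"
      by (rule has_derivative_continuous_on, rule has_derivative_at_withinI, rule \<phi>')
        (use in_ball r(2) in auto)
    moreover have "(\<phi> has_derivative (\<lambda>h. N (p + t *\<^sub>R w) \<bullet> h)) (at (p + t *\<^sub>R w))"
      if "0 < t" "t < 1" for t
      using in_ball r(2) \<phi>' that by auto
    ultimately obtain t where "0 < t" "t < 1" "\<phi> (p + w) - \<phi> p = N (p + t *\<^sub>R w) \<bullet> w"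
      using line_mvt[of p w \<phi> "\<lambda>t h. N (p + t *\<^sub>R w) \<bullet> h"] by blast
    with in_ball[of t] show ?thesis by auto
  qed
  show ?thesis
    unfolding S_def[symmetric] has_derivative_within_alt
  proof (intro conjI allI impI)
    show "bounded_linear (\<lambda>h. G x \<bullet> h)" by (rule bounded_linear_inner_right)
    fix e :: real assume "e > 0"
    define L where "L = 1 + 2 * C * norm n"
    define e' where "e' = e / L"
    have L: "L > 0" using pos by (simp add: L_def add_pos_pos)
    have e': "e' > 0" using \<open>e > 0\<close> L by (simp add: e'_def)
    obtain \<delta>1 where \<delta>1: "\<delta>1 > 0" "\<And>z. z \<in> S \<Longrightarrow> dist z x < \<delta>1 \<Longrightarrow> norm (G z - G x) < e'"
      using G e' unfolding S_def[symmetric] continuous_within_eps_delta dist_norm by blast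
    define \<delta> where "\<delta> = min r \<delta>1"
    have \<delta>: "\<delta> > 0" "\<delta> \<le> r" "\<delta> \<le> \<delta>1" using r(1) \<delta>1(1) by (auto simp: \<delta>_def)
    define E where "E = (\<lambda>z. f z - G x \<bullet> z)"
    have E_seg: "\<bar>E (p + w) - E p\<bar> \<le> e' * norm w"
      if ball: "\<And>t. 0 \<le> t \<Longrightarrow> t \<le> 1 \<Longrightarrow> dist (p + t *\<^sub>R w) x < \<delta>"
        and ge: "\<And>t. 0 \<le> t \<Longrightarrow> t \<le> 1 \<Longrightarrow> \<phi> (p + t *\<^sub>R w) \<ge> 0"
        and gt: "\<And>t. 0 < t \<Longrightarrow> t < 1 \<Longrightarrow> \<phi> (p + t *\<^sub>R w) > 0" for p w
    proof -
      have inB: "p + t *\<^sub>R w \<in> B" if "0 \<le> t" "t \<le> 1" for t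
        using r(2) ball[OF that] \<delta>(2) by auto
      have "continuous_on ((\<lambda>t. p + t *\<^sub>R w) ` {0..1}) f"
        by (rule continuous_on_subset[OF f]) (use inB ge in auto)
      then have "continuous_on ((\<lambda>t. p + t *\<^sub>R w) ` {0..1}) E"
        unfolding E_def by (intro continuous_intros)
      moreover have "(E has_derivative (\<lambda>h. G (p + t *\<^sub>R w) \<bullet> h - G x \<bullet> h)) (at (p + t *\<^sub>R w))"
        if "0 < t" "t < 1" for t
        unfolding E_def using inB gt that
        by (intro has_derivative_diff f' bounded_linear_imp_has_derivative bounded_linear_inner_right)
          auto
      ultimately obtain t where t: "0 < t" "t < 1"
        "E (p + w) - E p = G (p + t *\<^sub>R w) \<bullet> w - G x \<bullet> w"
        using line_mvt[of p w E "\<lambda>t h. G (p + t *\<^sub>R w) \<bullet> h - G x \<bullet> h"] by blast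
      have "p + t *\<^sub>R w \<in> S" using inB[of t] ge[of t] t by (simp add: S_def)
      moreover have "dist (p + t *\<^sub>R w) x < \<delta>1" using ball[of t] t \<delta>(3) by simp
      ultimately have "norm (G (p + t *\<^sub>R w) - G x) < e'" by (rule \<delta>1(2))
      then have "\<bar>(G (p + t *\<^sub>R w) - G x) \<bullet> w\<bar> \<le> e' * norm w"
        by (meson Cauchy_Schwarz_ineq2 less_imp_le mult_right_mono norm_ge_zero order_trans)
      then show ?thesis by (simp add: t(3) inner_diff_left)
    qed
    show "\<exists>d>0. \<forall>y\<in>S. norm (y - x) < d \<longrightarrow> norm (f y - f x - G x \<bullet> (y - x)) \<le> e * norm (y - x)"
    proof (intro exI[of _ "\<delta> / L"] conjI ballI impI)
      show "\<delta> / L > 0" using \<delta>(1) L by simp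
      fix y assume "y \<in> S" and small: "norm (y - x) < \<delta> / L"
      define d where "d = norm (y - x)"
      have dL: "d * L < \<delta>" using small L by (simp add: d_def pos_less_divide_eq)
      have d0: "d \<ge> 0" by (simp add: d_def)
      show "norm (f y - f x - G x \<bullet> (y - x)) \<le> e * norm (y - x)"
      proof (cases "d = 0")
        case True
        then show ?thesis by (simp add: d_def)
      next
        case False
        with d0 have d: "d > 0" by simp
        \<comment> \<open>The step \<open>s\<close> into the positive side is long enough to move from above \<open>x\<close> to above \<open>y\<close>
           along a straight line without touching the zero set.\<close>
        define s where "s = C * d"
        have s: "s > 0" using pos d by (simp add: s_def)
        have near: "dist (x + \<alpha> *\<^sub>R n + \<beta> *\<^sub>R (y - x)) x < \<delta>"
          if "0 \<le> \<alpha>" "\<alpha> \<le> s" "0 \<le> \<beta>" "\<beta> \<le> 1" for \<alpha> \<beta>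
        proof -
          have "dist (x + \<alpha> *\<^sub>R n + \<beta> *\<^sub>R (y - x)) x = norm (\<alpha> *\<^sub>R n + \<beta> *\<^sub>R (y - x))"
            by (simp add: dist_norm add.assoc)
          also have "\<dots> \<le> \<alpha> * norm n + \<beta> * d"
            using norm_triangle_ineq[of "\<alpha> *\<^sub>R n" "\<beta> *\<^sub>R (y - x)"] that by (simp add: d_def)
          also have "\<dots> \<le> s * norm n + 1 * d"
            using that d by (intro add_mono mult_right_mono) auto
          also have "\<dots> \<le> d * L" using pos d by (simp add: s_def L_def algebra_simps)
          finally show ?thesis using dL by linarith
        qed
        have up: "\<phi> (z + \<alpha> *\<^sub>R n) \<ge> \<alpha> * \<kappa>"
          if "0 \<le> \<alpha>" "\<alpha> \<le> s" "z = x \<or> z = y" for z \<alpha>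
        proof -
          have a: "dist (z + \<alpha> *\<^sub>R n) x < r" "dist z x < r"
            using near[of \<alpha> 0] near[of \<alpha> 1] near[of 0 0] near[of 0 1] that s \<delta>(2)
            by (auto simp: algebra_simps)
          obtain \<xi> where \<xi>: "dist \<xi> x < r" "\<phi> (z + \<alpha> *\<^sub>R n) - \<phi> z = \<alpha> * (N \<xi> \<bullet> n)"
            using \<phi>_mvt[OF a(2,1)] by auto
          have "\<alpha> * \<kappa> \<le> \<alpha> * (N \<xi> \<bullet> n)" using that Nn(1)[OF \<xi>(1)] by (intro mult_left_mono)
          moreover have "\<phi> z \<ge> 0" using that \<open>\<phi> x = 0\<close> \<open>y \<in> S\<close> by (auto simp: S_def)
          ultimately show ?thesis using \<xi>(2) by linarith
        qed
        have across: "\<phi> (x + s *\<^sub>R n + \<beta> *\<^sub>R (y - x)) > 0" if "0 \<le> \<beta>" "\<beta> \<le> 1" for \<beta>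
        proof -
          have a: "dist (x + s *\<^sub>R n + \<beta> *\<^sub>R (y - x)) x < r" "dist x x < r"
            using near[of s \<beta>] that s \<delta>(2) r(1) by auto
          obtain \<xi> where \<xi>: "dist \<xi> x < r" "\<phi> (x + s *\<^sub>R n + \<beta> *\<^sub>R (y - x)) - \<phi> x
              = N \<xi> \<bullet> (s *\<^sub>R n + \<beta> *\<^sub>R (y - x))"
            using \<phi>_mvt[of x "s *\<^sub>R n + \<beta> *\<^sub>R (y - x)"] a by (metis add.assoc)
          have "s * \<kappa> \<le> s * (N \<xi> \<bullet> n)" using s Nn(1)[OF \<xi>(1)] by (intro mult_left_mono) auto
          moreover have "\<bar>N \<xi> \<bullet> (\<beta> *\<^sub>R (y - x))\<bar> \<le> M * d"
          proof -
            have "\<bar>N \<xi> \<bullet> (\<beta> *\<^sub>R (y - x))\<bar> \<le> norm (N \<xi>) * norm (\<beta> *\<^sub>R (y - x))"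
              by (rule Cauchy_Schwarz_ineq2)
            also have "\<dots> \<le> M * d"
              using that Nn(2)[OF \<xi>(1)] pos(3) d
              by (intro mult_mono) (auto simp: d_def mult_left_le_one_le)
            finally show ?thesis .
          qed
          moreover have "s * \<kappa> = M * d + d" using pos by (simp add: s_def C_def field_simps)
          ultimately show ?thesis using \<xi>(2) \<open>\<phi> x = 0\<close> d by (simp add: inner_add_right)
        qed
        have sc: "0 \<le> t * s" "t * s \<le> s" if "0 \<le> t" "t \<le> 1" for t
          using that s by (auto intro: mult_left_le_one_le)
        have scp: "\<phi> (z + (t * s) *\<^sub>R n) > 0" if "0 < t" "t < 1" "z = x \<or> z = y" for t z
        proof -
          have "0 < (t * s) * \<kappa>" using that s pos by simp
          also have "\<dots> \<le> \<phi> (z + (t * s) *\<^sub>R n)" using up[of "t * s" z] sc[of t] that by auto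
          finally show ?thesis .
        qed
        have scn: "\<phi> (z + (t * s) *\<^sub>R n) \<ge> 0" if "0 \<le> t" "t \<le> 1" "z = x \<or> z = y" for t z
        proof -
          have "0 \<le> (t * s) * \<kappa>" using that s pos by simp
          also have "\<dots> \<le> \<phi> (z + (t * s) *\<^sub>R n)" using up[of "t * s" z] sc[of t] that by auto
          finally show ?thesis .
        qed
        have "\<bar>E (x + s *\<^sub>R n) - E x\<bar> \<le> e' * norm (s *\<^sub>R n)"
        proof (rule E_seg, goal_cases)
          case (1 t) with near[of "t * s" 0] sc[of t] show ?case by simp
        next
          case (2 t) with scn[of t x] show ?case by simp
        next
          case (3 t) with scp[of t x] show ?case by simp
        qed
        moreover have "\<bar>E (y + s *\<^sub>R n) - E y\<bar> \<le> e' * norm (s *\<^sub>R n)"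
        proof (rule E_seg, goal_cases)
          case (1 t) with near[of "t * s" 1] sc[of t] show ?case by (simp add: algebra_simps)
        next
          case (2 t) with scn[of t y] show ?case by simp
        next
          case (3 t) with scp[of t y] show ?case by simp
        qed
        moreover have "\<bar>E (x + s *\<^sub>R n + (y - x)) - E (x + s *\<^sub>R n)\<bar> \<le> e' * norm (y - x)"
        proof (rule E_seg, goal_cases)
          case (1 t) with near[of s t] s show ?case by simp
        next
          case (2 t) with across[of t] show ?case by simp
        next
          case (3 t) with across[of t] show ?case by simp
        qed
        moreover have "x + s *\<^sub>R n + (y - x) = y + s *\<^sub>R n" by simp
        ultimately have "\<bar>E y - E x\<bar> \<le> e' * norm (s *\<^sub>R n) + e' * norm (y - x) + e' * norm (s *\<^sub>R n)"
          by (smt (verit))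
        also have "\<dots> = e' * (L * d)"
          using s by (simp add: L_def s_def d_def algebra_simps)
        also have "\<dots> = e * d" using L by (simp add: e'_def)
        finally show ?thesis by (simp add: E_def d_def inner_diff_right algebra_simps)
      qed
    qed
  qed
qed

section \<open>Jets\<close>

text \<open>A family \<open>P\<close> of functions indexed by lists of coordinate directions is a jet of order \<open>q\<close> on \<open>A\<close> if it
  has the derivative structure of \<open>\<lambda>is. partials is f\<close>: the gradient of \<open>P is\<close> consists of the \<open>P (i # is)\<close>.
  Unlike iterated partial derivatives, jets can be extended to boundary points, subtracted and glued
  before it is known that the result consists of partial derivatives of one function.\<close>

definition jet_on :: "nat \<Rightarrow> (real^'d::finite) set \<Rightarrow> ('d list \<Rightarrow> real^'d \<Rightarrow> real) \<Rightarrow> bool" where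
  "jet_on q A P \<longleftrightarrow> (\<forall>is. length is < q \<longrightarrow>
     (\<forall>y\<in>A. (P is has_derivative (\<lambda>h. (\<chi> i. P (i # is) y) \<bullet> h)) (at y)))"

lemma jet_onD:
  "jet_on q A P \<Longrightarrow> length is < q \<Longrightarrow> y \<in> A \<Longrightarrow>
    (P is has_derivative (\<lambda>h. (\<chi> i. P (i # is) y) \<bullet> h)) (at y)"
  by (simp add: jet_on_def)

lemma jet_on_subset: "jet_on q A P \<Longrightarrow> A' \<subseteq> A \<Longrightarrow> jet_on q A' P"
  by (auto simp: jet_on_def)

lemma has_derivative_grad:
  fixes f :: "real^'d::finite \<Rightarrow> real"
  assumes "f differentiable (at x)"
  shows "(f has_derivative (\<lambda>h. grad f x \<bullet> h)) (at x)"
proof -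
  let ?D = "frechet_derivative f (at x)"
  have D: "(f has_derivative ?D) (at x)" using assms frechet_derivative_works by blast
  then have lin: "linear ?D" using has_derivative_bounded_linear bounded_linear.linear by blast
  have "?D h = grad f x \<bullet> h" for h
  proof -
    have "?D h = ?D (\<Sum>i\<in>UNIV. h $ i *\<^sub>R axis i 1)"
      using basis_expansion[of h] by (simp add: scalar_mult_eq_scaleR)
    also have "\<dots> = (\<Sum>i\<in>UNIV. h $ i * partial i f x)"
      using lin by (simp add: linear_sum linear_cmul partial_def)
    finally show ?thesis by (simp add: grad_def inner_vec_def mult.commute)
  qed
  then have "?D = (\<lambda>h. grad f x \<bullet> h)" by auto
  with D show ?thesis by simp
qed

lemma partial_eqI:
  fixes f :: "real^'d::finite \<Rightarrow> real"
  assumes "(f has_derivative (\<lambda>h. G \<bullet> h)) (at x)"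
  shows "partial i f x = G $ i"
  using frechet_derivative_at[OF assms, symmetric] by (simp add: partial_def inner_axis)

lemma partial_cong_open:
  assumes "open U" "x \<in> U" "\<And>y. y \<in> U \<Longrightarrow> f y = g y"
  shows "partial i f x = partial i g x"
proof -
  have "(f has_derivative D) (at x) \<longleftrightarrow> (g has_derivative D) (at x)" for D
    using has_derivative_transform_within_open[OF _ assms(1,2), of f D UNIV g]
      has_derivative_transform_within_open[OF _ assms(1,2), of g D UNIV f] assms(3) by auto
  then show ?thesis by (simp add: partial_def frechet_derivative_def)
qed

lemma jet_on_partials:
  assumes "\<And>is x. length is < q \<Longrightarrow> x \<in> A \<Longrightarrow> partials is f differentiable (at x)"
  shows "jet_on q A (\<lambda>is. partials is f)"
  using has_derivative_grad[OF assms] by (simp add: jet_on_def grad_def)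

lemma LC_with_jet: "LC_with q \<Lambda> A f \<Longrightarrow> jet_on q A (\<lambda>is. partials is f)"
  by (rule jet_on_partials) (simp add: LC_with_def)

lemma jet_on_cong:
  fixes P Q :: "'d::finite list \<Rightarrow> real^'d \<Rightarrow> real"
  assumes "open A" "jet_on q A P" "\<And>is y. length is \<le> q \<Longrightarrow> y \<in> A \<Longrightarrow> P is y = Q is y"
  shows "jet_on q A Q"
  unfolding jet_on_def
proof (intro allI impI ballI)
  fix "is" :: "'d list" and y assume *: "length is < q" "y \<in> A"
  have "(P is has_derivative (\<lambda>h. (\<chi> i. P (i # is) y) \<bullet> h)) (at y)"
    using jet_onD[OF assms(2) *] .
  moreover have "(\<chi> i. P (i # is) y) = (\<chi> i. Q (i # is) y)" using assms(3) * by (simp add: vec_eq_iff)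
  ultimately show "(Q is has_derivative (\<lambda>h. (\<chi> i. Q (i # is) y) \<bullet> h)) (at y)"
    using has_derivative_transform_within_open[OF _ assms(1) *(2), of "P is" _ UNIV "Q is"] assms(3) *
    by simp
qed

lemma jet_on_add:
  fixes P Q :: "'d::finite list \<Rightarrow> real^'d \<Rightarrow> real"
  assumes "jet_on q A P" "jet_on q A Q"
  shows "jet_on q A (\<lambda>is y. P is y + Q is y)"
  unfolding jet_on_def
proof (intro allI impI ballI)
  fix "is" :: "'d list" and y assume *: "length is < q" "y \<in> A"
  have "(\<chi> i. P (i # is) y + Q (i # is) y) = (\<chi> i. P (i # is) y) + (\<chi> i. Q (i # is) y)"
    by (simp add: vec_eq_iff)
  then show "((\<lambda>y. P is y + Q is y) has_derivative (\<lambda>h. (\<chi> i. P (i # is) y + Q (i # is) y) \<bullet> h)) (at y)"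
    using has_derivative_add[OF jet_onD[OF assms(1) *] jet_onD[OF assms(2) *]]
    by (simp add: inner_add_left)
qed

lemma jet_on_diff:
  fixes P Q :: "'d::finite list \<Rightarrow> real^'d \<Rightarrow> real"
  assumes "jet_on q A P" "jet_on q A Q"
  shows "jet_on q A (\<lambda>is y. P is y - Q is y)"
  unfolding jet_on_def
proof (intro allI impI ballI)
  fix "is" :: "'d list" and y assume *: "length is < q" "y \<in> A"
  have "(\<chi> i. P (i # is) y - Q (i # is) y) = (\<chi> i. P (i # is) y) - (\<chi> i. Q (i # is) y)"
    by (simp add: vec_eq_iff)
  then show "((\<lambda>y. P is y - Q is y) has_derivative (\<lambda>h. (\<chi> i. P (i # is) y - Q (i # is) y) \<bullet> h)) (at y)"
    using has_derivative_diff[OF jet_onD[OF assms(1) *] jet_onD[OF assms(2) *]]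
    by (simp add: inner_diff_left)
qed

lemma jet_on_partials_eq:
  assumes "open A" "jet_on q A P" "\<And>y. y \<in> A \<Longrightarrow> f y = P [] y"
  shows "length is \<le> q \<Longrightarrow> y \<in> A \<Longrightarrow> partials is f y = P is y"
proof (induction "is" arbitrary: y)
  case Nil
  then show ?case using assms(3) by simp
next
  case (Cons i "is")
  have "partials (i # is) f y = partial i (P is) y"
    unfolding partials.simps
    by (rule partial_cong_open[OF assms(1) Cons.prems(2)]) (use Cons in simp)
  also have "\<dots> = P (i # is) y"
    using partial_eqI[OF jet_onD[OF assms(2) _ Cons.prems(2)], of "is" i] Cons.prems(1) by simp
  finally show ?case .
qed

lemma jet_on_imp_LC_with:
  assumes "open A" "jet_on q A P" "\<And>y. y \<in> A \<Longrightarrow> f y = P [] y"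
    and lip: "\<And>is. length is \<le> q \<Longrightarrow> (\<Lambda> (length is))-lipschitz_on A (P is)"
  shows "LC_with q \<Lambda> A f"
  unfolding LC_with_def
proof (intro conjI allI impI ballI)
  note eq = jet_on_partials_eq[OF assms(1-3)]
  fix "is" :: "'a list"
  show "(\<Lambda> (length is))-lipschitz_on A (partials is f)" if "length is \<le> q"
    using lip[OF that] by (rule lipschitz_on_transform) (simp add: eq that)
  show "partials is f differentiable (at y)" if "length is < q" "y \<in> A" for y
  proof -
    have "(partials is f has_derivative (\<lambda>h. (\<chi> i. P (i # is) y) \<bullet> h)) (at y)"
      by (rule has_derivative_transform_within_open[OF jet_onD[OF assms(2) that] assms(1) that(2)])
        (simp add: eq less_imp_le[OF that(1)])
    then show ?thesis unfolding differentiable_def by blast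
  qed
qed

lemma jet_on_swap:
  assumes "open A" "jet_on q A P" "y \<in> A" "length is + 2 \<le> q"
  shows "P (i # j # is) y = P (j # i # is) y"
proof -
  have D: "(P is has_derivative (\<lambda>h. (\<chi> i. P (i # is) z) \<bullet> h)) (at z)" if "z \<in> A" for z
    using jet_onD[OF assms(2) _ that] assms(4) by simp
  have D2: "((\<lambda>z. (\<chi> i. P (i # is) z) \<bullet> axis j 1) has_derivative (\<lambda>h. (\<chi> i. P (i # j # is) y) \<bullet> h)) (at y)" for j
    using jet_onD[OF assms(2) _ assms(3), of "j # is"] assms(4) by (simp add: inner_axis)
  show ?thesis
    using second_derivative_symmetric[OF assms(1,3) D D2[of j] D2[of i]] by (simp add: inner_axis)
qed

lemma jet_on_rotate:
  assumes "open A" "jet_on q A P"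
  shows "y \<in> A \<Longrightarrow> length as + length bs < q \<Longrightarrow> P (i # as @ bs) y = P (as @ i # bs) y"
proof (induction as arbitrary: y)
  case Nil
  then show ?case by simp
next
  case (Cons a as)
  have "P (i # (a # as) @ bs) y = P (a # i # as @ bs) y"
    using jet_on_swap[OF assms Cons.prems(1)] Cons.prems(2) by simp
  also have "\<dots> = P (a # as @ i # bs) y"
  proof -
    have "((P (as @ i # bs)) has_derivative (\<lambda>h. (\<chi> j. P (j # i # as @ bs) y) \<bullet> h)) (at y)"
      by (rule has_derivative_transform_within_open[OF jet_onD[OF assms(2)] assms(1)])
        (use Cons in auto)
    from partial_eqI[OF this, of a]
    show ?thesis using partial_eqI[OF jet_onD[OF assms(2) _ Cons.prems(1), of "as @ i # bs"], of a] Cons.prems(2)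
      by simp
  qed
  finally show ?case by simp
qed

lemma eq_on_limit_points:
  fixes f g :: "'a::t2_space \<Rightarrow> 'b::t2_space"
  assumes "S \<subseteq> closure A" "A \<subseteq> S" "continuous_on S f" "continuous_on S g"
    and "\<And>y. y \<in> A \<Longrightarrow> f y = g y" "y \<in> S"
  shows "f y = g y"
proof (cases "y \<in> A")
  case False
  then have nt: "at y within A \<noteq> bot"
    using assms(1,6) by (auto simp: at_within_eq_bot_iff)
  have "(f \<longlongrightarrow> f y) (at y within A)" "(g \<longlongrightarrow> g y) (at y within A)"
    using assms(3,4,6) by (auto simp: continuous_on_def intro: tendsto_within_subset[OF _ assms(2)])

  moreover have "(f \<longlongrightarrow> g y) (at y within A) \<longleftrightarrow> (g \<longlongrightarrow> g y) (at y within A)"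
    by (rule Lim_cong_within) (use assms(5) in simp_all)
  ultimately show ?thesis using tendsto_unique[OF nt] by simp
qed (use assms in auto)

section \<open>Regular level sets\<close>

text \<open>An open set \<open>B\<close> divided by the regular zero set of a smooth function \<open>\<phi>\<close>.\<close>

locale regular_level_set =
  fixes B :: "(real^'d::finite) set" and \<phi> :: "real^'d \<Rightarrow> real"
  assumes open_B: "open B"
    and smooth: "smooth_on B \<phi>"
    and regular: "\<And>x. x \<in> B \<Longrightarrow> \<phi> x = 0 \<Longrightarrow> grad \<phi> x \<noteq> 0"
begin

definition pos :: "(real^'d) set" where "pos = {y\<in>B. \<phi> y > 0}"
definition neg :: "(real^'d) set" where "neg = {y\<in>B. \<phi> y < 0}"
definition nonneg :: "(real^'d) set" where "nonneg = {y\<in>B. \<phi> y \<ge> 0}"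
definition nonpos :: "(real^'d) set" where "nonpos = {y\<in>B. \<phi> y \<le> 0}"

lemmas side_defs = pos_def neg_def nonneg_def nonpos_def

lemma phi_has_derivative: "y \<in> B \<Longrightarrow> (\<phi> has_derivative (\<lambda>h. grad \<phi> y \<bullet> h)) (at y)"
  using smooth has_derivative_grad by (metis partials.simps(1) smooth_on_def)

lemma continuous_on_phi: "continuous_on B \<phi>"
  by (rule has_derivative_continuous_on, rule has_derivative_at_withinI, rule phi_has_derivative)

lemma isCont_grad_phi:
  assumes "y \<in> B" shows "isCont (grad \<phi>) y"
proof -
  have "isCont (partial i \<phi>) y" for i
    using smooth assms differentiable_imp_continuous_within unfolding smooth_on_def
    by (metis partials.simps)
  then show ?thesis
    unfolding isCont_def by (intro vec_tendstoI) (simp add: grad_def)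
qed

lemma open_sides: "open pos" "open neg"
proof -
  have "open (B \<inter> \<phi> -` {0<..})" "open (B \<inter> \<phi> -` {..<0})"
    by (intro continuous_open_preimage[OF continuous_on_phi open_B] open_greaterThan open_lessThan)+
  moreover have "pos = B \<inter> \<phi> -` {0<..}" "neg = B \<inter> \<phi> -` {..<0}" by (auto simp: side_defs)
  ultimately show "open pos" "open neg" by auto
qed

text \<open>The rays along which \<open>plus_value\<close> and \<open>minus_value\<close> are taken enter the respective open sides, so
  these values are determined by the limits within \<open>pos\<close> and \<open>neg\<close>.\<close>

lemma normal_ray:
  assumes "x \<in> B" "\<phi> x = 0"
  shows "filterlim (\<lambda>s. x + s *\<^sub>R grad \<phi> x) (at x within pos) (at_right 0)"
    and "filterlim (\<lambda>s. x - s *\<^sub>R grad \<phi> x) (at x within neg) (at_right 0)"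
proof -
  define n where "n = grad \<phi> x"
  have n: "n \<noteq> 0" using regular assms by (simp add: n_def)
  have der: "((\<lambda>s. \<phi> (x + s *\<^sub>R (c *\<^sub>R n))) has_derivative (\<lambda>s. n \<bullet> (s *\<^sub>R (c *\<^sub>R n)))) (at 0)" for c
  proof -
    have 1: "((\<lambda>s. x + s *\<^sub>R (c *\<^sub>R n)) has_derivative (\<lambda>s. s *\<^sub>R (c *\<^sub>R n))) (at 0)"
      by (auto intro!: derivative_eq_intros)
    have "(\<phi> has_derivative (\<lambda>h. n \<bullet> h)) (at (x + 0 *\<^sub>R (c *\<^sub>R n)))"
      using phi_has_derivative[OF assms(1)] by (simp add: n_def)
    from has_derivative_compose[OF 1 this] show ?thesis .
  qed
  have dr: "((\<lambda>s. \<phi> (x + s *\<^sub>R (c *\<^sub>R n))) has_real_derivative c * (n \<bullet> n)) (at 0)" for c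
  proof -
    have "(\<lambda>s. n \<bullet> (s *\<^sub>R (c *\<^sub>R n))) = (*) (c * (n \<bullet> n))" by (simp add: fun_eq_iff)
    then show ?thesis using der[of c] by (simp only: has_field_derivative_def)
  qed
  have nn: "n \<bullet> n > 0" using n by simp
  have evB: "\<forall>\<^sub>F s in at_right 0. x + s *\<^sub>R (c *\<^sub>R n) \<in> B" for c
  proof -
    have "((\<lambda>s. x + s *\<^sub>R (c *\<^sub>R n)) \<longlongrightarrow> x + 0 *\<^sub>R (c *\<^sub>R n)) (at_right 0)"
      by (intro tendsto_intros)
    from topological_tendstoD[OF this open_B] show ?thesis using assms(1) by simp
  qed
  have evp: "\<forall>\<^sub>F s in at_right 0. \<phi> (x + s *\<^sub>R n) > 0"
  proof -
    obtain d where "d > 0" "\<And>s. 0 < s \<Longrightarrow> s < d \<Longrightarrow> \<phi> (x + s *\<^sub>R n) > 0"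
      using DERIV_pos_inc_right[OF dr[of 1]] nn assms(2) by auto
    then show ?thesis unfolding eventually_at_right_field by auto
  qed
  have evn: "\<forall>\<^sub>F s in at_right 0. \<phi> (x - s *\<^sub>R n) < 0"
  proof -
    obtain d where "d > 0" "\<And>s. 0 < s \<Longrightarrow> s < d \<Longrightarrow> \<phi> (x - s *\<^sub>R n) < 0"
      using DERIV_neg_dec_right[OF dr[of "-1"]] nn assms(2) by auto
    then show ?thesis unfolding eventually_at_right_field by auto
  qed
  have s0: "\<forall>\<^sub>F s::real in at_right 0. s \<noteq> 0" by (simp add: eventually_at_filter)
  have "\<forall>\<^sub>F s in at_right 0. x + s *\<^sub>R n \<in> pos \<and> x + s *\<^sub>R n \<noteq> x"
    using evB[of 1] evp s0 by eventually_elim (use n in \<open>auto simp: pos_def\<close>)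
  moreover have "((\<lambda>s. x + s *\<^sub>R n) \<longlongrightarrow> x + 0 *\<^sub>R n) (at_right 0)"
    by (intro tendsto_intros)
  ultimately show "filterlim (\<lambda>s. x + s *\<^sub>R grad \<phi> x) (at x within pos) (at_right 0)"
    by (simp add: filterlim_at n_def)
  have "\<forall>\<^sub>F s in at_right 0. x - s *\<^sub>R n \<in> neg \<and> x - s *\<^sub>R n \<noteq> x"
    using evB[of "-1"] evn s0 by eventually_elim (use n in \<open>auto simp: neg_def\<close>)
  moreover have "((\<lambda>s. x - s *\<^sub>R n) \<longlongrightarrow> x - 0 *\<^sub>R n) (at_right 0)"
    by (intro tendsto_intros)
  ultimately show "filterlim (\<lambda>s. x - s *\<^sub>R grad \<phi> x) (at x within neg) (at_right 0)"
    by (simp add: filterlim_at n_def)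
qed

lemma plus_value_eq:
  assumes "x \<in> B" "\<phi> x = 0" "(f \<longlongrightarrow> l) (at x within pos)"
  shows "plus_value \<phi> f x = l"
  unfolding plus_value_def
  using filterlim_compose[OF assms(3) normal_ray(1)[OF assms(1,2)]]
  by (intro tendsto_Lim) auto

lemma minus_value_eq:
  assumes "x \<in> B" "\<phi> x = 0" "(f \<longlongrightarrow> l) (at x within neg)"
  shows "minus_value \<phi> f x = l"
  unfolding minus_value_def
  using filterlim_compose[OF assms(3) normal_ray(2)[OF assms(1,2)]]
  by (intro tendsto_Lim) auto

lemma nonneg_subset_closure: "nonneg \<subseteq> closure pos"
proof
  fix x assume x: "x \<in> nonneg"
  show "x \<in> closure pos"
  proof (cases "\<phi> x = 0")
    case True
    then have "at x within pos \<noteq> bot"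
      using normal_ray(1)[of x] x by (auto simp: nonneg_def filterlim_def bot_unique filtermap_bot_iff)
    then have "x \<in> closure (pos - {x})" by (simp add: at_within_eq_bot_iff)
    then show ?thesis using closure_mono[of "pos - {x}" pos] by blast
  next
    case False
    then have "x \<in> pos" using x by (auto simp: side_defs)
    then show ?thesis using closure_subset by blast
  qed
qed

lemma nonpos_subset_closure: "nonpos \<subseteq> closure neg"
proof
  fix x assume x: "x \<in> nonpos"
  show "x \<in> closure neg"
  proof (cases "\<phi> x = 0")
    case True
    then have "at x within neg \<noteq> bot"
      using normal_ray(2)[of x] x by (auto simp: nonpos_def filterlim_def bot_unique filtermap_bot_iff)
    then have "x \<in> closure (neg - {x})" by (simp add: at_within_eq_bot_iff)
    then show ?thesis using closure_mono[of "neg - {x}" neg] by blast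
  next
    case False
    then have "x \<in> neg" using x by (auto simp: side_defs)
    then show ?thesis using closure_subset by blast
  qed
qed

lemma jet_has_derivative_nonneg:
  assumes "jet_on q pos P" "\<And>is. length is \<le> q \<Longrightarrow> continuous_on nonneg (P is)"
    and "x \<in> B" "\<phi> x = 0" "length is < q"
  shows "(P is has_derivative (\<lambda>h. (\<chi> i. P (i # is) x) \<bullet> h)) (at x within nonneg)"
  unfolding nonneg_def
proof (rule one_sided_has_derivative[where G = "\<lambda>y. \<chi> i. P (i # is) y"])
  have "x \<in> nonneg" using assms(3,4) by (simp add: nonneg_def)
  then show "continuous (at x within {y \<in> B. 0 \<le> \<phi> y}) (\<lambda>y. \<chi> i. P (i # is) y)"
    using assms(2,5) unfolding continuous_within nonneg_def[symmetric]
    by (intro vec_tendstoI) (auto simp: continuous_on_def)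
qed (use assms open_B phi_has_derivative isCont_grad_phi regular jet_onD[OF assms(1)] in
    \<open>auto simp: side_defs\<close>)

lemma jet_has_derivative_nonpos:
  assumes "jet_on q neg P" "\<And>is. length is \<le> q \<Longrightarrow> continuous_on nonpos (P is)"
    and "x \<in> B" "\<phi> x = 0" "length is < q"
  shows "(P is has_derivative (\<lambda>h. (\<chi> i. P (i # is) x) \<bullet> h)) (at x within nonpos)"
proof -
  have eq: "nonpos = {y\<in>B. - \<phi> y \<ge> 0}" by (auto simp: nonpos_def)
  have x: "x \<in> nonpos" using assms(3,4) by (simp add: nonpos_def)
  show ?thesis
    unfolding eq
  proof (rule one_sided_has_derivative[where G = "\<lambda>y. \<chi> i. P (i # is) y" and N = "\<lambda>y. - grad \<phi> y"])
    show "continuous (at x within {y \<in> B. 0 \<le> - \<phi> y}) (\<lambda>y. \<chi> i. P (i # is) y)"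
      using assms(2,5) x unfolding continuous_within eq[symmetric]
      by (intro vec_tendstoI) (auto simp: continuous_on_def)
    show "((\<lambda>y. - \<phi> y) has_derivative (\<lambda>h. - grad \<phi> y \<bullet> h)) (at y)" if "y \<in> B" for y
      using has_derivative_minus[OF phi_has_derivative[OF that]] by simp
    show "(P is has_derivative (\<lambda>h. (\<chi> i. P (i # is) y) \<bullet> h)) (at y)"
      if "y \<in> B" "0 < - \<phi> y" for y
      using jet_onD[OF assms(1,5)] that by (simp add: neg_def)
    show "continuous_on {y \<in> B. 0 \<le> - \<phi> y} (P is)"
      unfolding eq[symmetric] using assms(2,5) by simp
  qed (use assms open_B isCont_grad_phi regular in auto)
qed

text \<open>\<open>F\<close> need only be differentiable relative to the zero set; no parametrisation of
  the zero set is used.\<close>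

lemma tangential_derivative_zero:
  fixes F :: "real^'d \<Rightarrow> real"
  assumes x: "x \<in> B" "\<phi> x = 0"
    and zero: "\<And>y. y \<in> B \<Longrightarrow> \<phi> y = 0 \<Longrightarrow> F y = 0"
    and F': "(F has_derivative (\<lambda>h. D \<bullet> h)) (at x within {y\<in>B. \<phi> y = 0})"
    and w: "grad \<phi> x \<bullet> w = 0"
  shows "D \<bullet> w = 0"
proof -
  define n where "n = grad \<phi> x"
  have n: "norm n > 0" using regular x by (simp add: n_def)
  define K where "K = norm w + norm n"
  have K: "K > 0" using n by (simp add: K_def add_nonneg_pos)
  have bound: "\<bar>D \<bullet> w\<bar> \<le> \<eta> * (\<bar>D \<bullet> n\<bar> + K)" if \<eta>: "0 < \<eta>" "\<eta> \<le> 1" for \<eta>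
  proof -
    define e where "e = \<eta> * (norm n)\<^sup>2 / (2 * K)"
    have e: "e > 0" using \<eta> n K by (simp add: e_def)
    obtain d1 where d1: "d1 > 0"
      "\<And>y. norm (y - x) < d1 \<Longrightarrow> \<bar>\<phi> y - n \<bullet> (y - x)\<bar> \<le> e * norm (y - x)"
    proof -
      obtain d where "d > 0" "\<forall>y. norm (y - x) < d \<longrightarrow>
          norm (\<phi> y - \<phi> x - n \<bullet> (y - x)) \<le> e * norm (y - x)"
        using phi_has_derivative[OF x(1)] e unfolding has_derivative_at_alt n_def by blast
      then show thesis using that[of d] x(2) by simp
    qed
    obtain d2 where d2: "d2 > 0"
      "\<And>y. y \<in> B \<Longrightarrow> \<phi> y = 0 \<Longrightarrow> norm (y - x) < d2 \<Longrightarrow> \<bar>D \<bullet> (y - x)\<bar> \<le> \<eta> * norm (y - x)"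
    proof -
      obtain d where "d > 0" "\<forall>y\<in>{y\<in>B. \<phi> y = 0}. norm (y - x) < d \<longrightarrow>
          norm (F y - F x - D \<bullet> (y - x)) \<le> \<eta> * norm (y - x)"
        using F' \<eta>(1) unfolding has_derivative_within_alt by blast
      then show thesis using that[of d] zero x by auto
    qed
    obtain d3 where d3: "d3 > 0" "ball x d3 \<subseteq> B" using open_B x(1) open_contains_ball by blast
    define t where "t = min d1 (min d2 d3) / (2 * K)"
    have t: "t > 0" using d1(1) d2(1) d3(1) K by (simp add: t_def)
    have tK: "t * K < d1" "t * K < d2" "t * K < d3"
      using d1(1) d2(1) d3(1) K by (simp_all add: t_def)
    \<comment> \<open>The intermediate value theorem corrects the tangential step \<open>t *\<^sub>R w\<close> by a small normal step
       so as to land on the zero set.\<close>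
    define \<gamma> where "\<gamma> = (\<lambda>\<sigma>. x + t *\<^sub>R (w + (\<sigma> * \<eta>) *\<^sub>R n))"
    have small: "norm (\<gamma> \<sigma> - x) \<le> t * K" if "\<bar>\<sigma>\<bar> \<le> 1" for \<sigma>
    proof -
      have "norm (\<gamma> \<sigma> - x) = t * norm (w + (\<sigma> * \<eta>) *\<^sub>R n)" using t by (simp add: \<gamma>_def)
      also have "\<dots> \<le> t * (norm w + \<bar>\<sigma> * \<eta>\<bar> * norm n)"
        using t norm_triangle_ineq[of w "(\<sigma> * \<eta>) *\<^sub>R n"] by (intro mult_left_mono) auto
      also have "\<dots> \<le> t * (norm w + 1 * norm n)"
        using that \<eta> t by (intro mult_left_mono add_left_mono mult_right_mono)
          (auto simp: abs_mult mult_le_one)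
      finally show ?thesis by (simp add: K_def)
    qed
    have \<gamma>B: "\<gamma> \<sigma> \<in> B" if "\<bar>\<sigma>\<bar> \<le> 1" for \<sigma>
    proof -
      have "dist x (\<gamma> \<sigma>) < d3" using small[OF that] tK(3) by (simp add: dist_norm norm_minus_commute)
      then show ?thesis using d3(2) by auto
    qed
    define X where "X = t * \<eta> * (norm n)\<^sup>2"
    have X: "X > 0" using t \<eta> n by (simp add: X_def)
    have \<phi>\<gamma>: "\<bar>\<phi> (\<gamma> \<sigma>) - \<sigma> * X\<bar> \<le> X / 2" if "\<bar>\<sigma>\<bar> \<le> 1" for \<sigma>
    proof -
      have "n \<bullet> (\<gamma> \<sigma> - x) = \<sigma> * X"
        using w by (simp add: \<gamma>_def X_def inner_add_right n_def[symmetric] power2_norm_eq_inner)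
      then have "\<bar>\<phi> (\<gamma> \<sigma>) - \<sigma> * X\<bar> \<le> e * norm (\<gamma> \<sigma> - x)"
        using d1(2)[of "\<gamma> \<sigma>"] small[OF that] tK(1) by simp
      also have "\<dots> \<le> e * (t * K)" using small[OF that] e by (intro mult_left_mono) auto
      also have "\<dots> = X / 2" using K by (simp add: e_def X_def)
      finally show ?thesis .
    qed
    have "\<phi> (\<gamma> (-1)) \<le> 0" using abs_le_D1[OF \<phi>\<gamma>[of "-1"]] X by simp
    moreover have "\<phi> (\<gamma> 1) \<ge> 0" using abs_le_D2[OF \<phi>\<gamma>[of 1]] X by simp
    moreover have "continuous_on {-1..1} (\<lambda>\<sigma>. \<phi> (\<gamma> \<sigma>))"
    proof (rule continuous_on_compose2[OF continuous_on_phi])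
      show "continuous_on {-1..1} \<gamma>" unfolding \<gamma>_def by (intro continuous_intros)
      show "\<gamma> ` {-1..1} \<subseteq> B" using \<gamma>B by auto
    qed
    ultimately obtain \<sigma> where \<sigma>: "-1 \<le> \<sigma>" "\<sigma> \<le> 1" "\<phi> (\<gamma> \<sigma>) = 0"
      using IVT'[of "\<lambda>\<sigma>. \<phi> (\<gamma> \<sigma>)" "-1" 0 1] by auto
    then have \<sigma>1: "\<bar>\<sigma>\<bar> \<le> 1" by auto
    have "\<bar>D \<bullet> (\<gamma> \<sigma> - x)\<bar> \<le> \<eta> * norm (\<gamma> \<sigma> - x)"
      using d2(2) \<gamma>B[OF \<sigma>1] \<sigma>(3) small[OF \<sigma>1] tK(2) by simp
    also have "\<dots> \<le> \<eta> * (t * K)" using small[OF \<sigma>1] \<eta> by (intro mult_left_mono) auto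
    finally have "\<bar>t * (D \<bullet> w + \<sigma> * \<eta> * (D \<bullet> n))\<bar> \<le> t * (\<eta> * K)"
      by (simp add: \<gamma>_def inner_add_right mult_ac)
    then have "\<bar>D \<bullet> w + \<sigma> * \<eta> * (D \<bullet> n)\<bar> \<le> \<eta> * K"
      using t by (simp add: abs_mult)
    moreover have "\<bar>\<sigma> * \<eta> * (D \<bullet> n)\<bar> \<le> \<eta> * \<bar>D \<bullet> n\<bar>"
      using \<sigma>1 \<eta> by (simp add: abs_mult mult_left_le_one_le mult_right_mono)
    ultimately show ?thesis by (simp add: distrib_left)
  qed
  have "\<bar>D \<bullet> w\<bar> \<le> 0 + \<epsilon>" if "\<epsilon> > 0" for \<epsilon>
  proof -
    define C where "C = \<bar>D \<bullet> n\<bar> + K"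
    have C: "C > 0" using K by (simp add: C_def)
    have "\<bar>D \<bullet> w\<bar> \<le> min 1 (\<epsilon> / C) * C" using bound[of "min 1 (\<epsilon> / C)"] C that by (simp add: C_def)
    also have "\<dots> \<le> \<epsilon> / C * C" using C by (intro mult_right_mono) auto
    finally show ?thesis using C by simp
  qed
  then show ?thesis using field_le_epsilon[of "\<bar>D \<bullet> w\<bar>" 0] by auto
qed

end

section \<open>Iterated normal derivatives\<close>

text \<open>All partial derivatives of orders \<open>0, \<dots>, n\<close> are differentiable on \<open>U\<close>. Smoothness is the
  conjunction over all \<open>n\<close>, and closure properties are proved by induction on \<open>n\<close>.\<close>

definition diff_upto :: "nat \<Rightarrow> (real^'d::finite) set \<Rightarrow> (real^'d \<Rightarrow> real) \<Rightarrow> bool" where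
  "diff_upto n U f \<longleftrightarrow> (\<forall>is. length is \<le> n \<longrightarrow> (\<forall>x\<in>U. partials is f differentiable (at x)))"

lemma smooth_on_iff_diff_upto: "smooth_on U f \<longleftrightarrow> (\<forall>n. diff_upto n U f)"
  by (auto simp: smooth_on_def diff_upto_def)

lemma partials_snoc: "partials (is @ [i]) f = partials is (partial i f)"
  by (induction "is") auto

lemma diff_upto_0: "diff_upto 0 U f \<longleftrightarrow> (\<forall>x\<in>U. f differentiable (at x))"
  by (simp add: diff_upto_def)

lemma diff_upto_Suc:
  "diff_upto (Suc n) U f \<longleftrightarrow> (\<forall>x\<in>U. f differentiable (at x)) \<and> (\<forall>i. diff_upto n U (partial i f))"
proof (intro iffI conjI)
  assume f: "diff_upto (Suc n) U f"
  then show "\<forall>x\<in>U. f differentiable (at x)"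
    unfolding diff_upto_def by (metis partials.simps(1) list.size(3) zero_le)
  show "\<forall>i. diff_upto n U (partial i f)"
    unfolding diff_upto_def
  proof (intro allI impI)
    fix i and "is" :: "'a list" assume "length is \<le> n"
    then have "length (is @ [i]) \<le> Suc n" by simp
    with f show "\<forall>x\<in>U. partials is (partial i f) differentiable (at x)"
      unfolding diff_upto_def partials_snoc[symmetric] by blast
  qed
next
  assume f: "(\<forall>x\<in>U. f differentiable (at x)) \<and> (\<forall>i. diff_upto n U (partial i f))"
  show "diff_upto (Suc n) U f"
    unfolding diff_upto_def
  proof (intro allI impI)
    fix "is" :: "'a list" assume l: "length is \<le> Suc n"
    show "\<forall>x\<in>U. partials is f differentiable (at x)"
    proof (cases "is" rule: rev_cases)
      case Nil
      then show ?thesis using f by simp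
    next
      case (snoc js i)
      then show ?thesis using f l by (simp add: partials_snoc diff_upto_def)
    qed
  qed
qed

lemma diff_upto_cong:
  assumes "open U" "\<And>x. x \<in> U \<Longrightarrow> f x = g x" "diff_upto n U f"
  shows "diff_upto n U g"
  using assms(2,3)
proof (induction n arbitrary: f g)
  case (0 f g)
  then show ?case
    unfolding diff_upto_0 differentiable_def
    using has_derivative_transform_within_open[OF _ assms(1)] by blast
next
  case (Suc n f g)
  have "\<forall>x\<in>U. g differentiable (at x)"
    using Suc.prems unfolding diff_upto_Suc differentiable_def
    using has_derivative_transform_within_open[OF _ assms(1)] by blast
  moreover have "diff_upto n U (partial i g)" for i
  proof (rule Suc.IH)
    show "partial i f x = partial i g x" if "x \<in> U" for x
      by (rule partial_cong_open[OF assms(1) that Suc.prems(1)])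
    show "diff_upto n U (partial i f)" using Suc.prems(2) by (simp add: diff_upto_Suc)
  qed
  ultimately show ?case by (simp add: diff_upto_Suc)
qed

lemma partial_add:
  assumes "f differentiable (at x)" "g differentiable (at x)"
  shows "partial i (\<lambda>x. f x + g x) x = partial i f x + partial i g x"
  using partial_eqI[of "\<lambda>x. f x + g x" "grad f x + grad g x" x i]
    has_derivative_add[OF has_derivative_grad[OF assms(1)] has_derivative_grad[OF assms(2)]]
  by (simp add: inner_add_left grad_def)

lemma partial_mult:
  assumes "f differentiable (at x)" "g differentiable (at x)"
  shows "partial i (\<lambda>x. f x * g x) x = f x * partial i g x + partial i f x * g x"
  using partial_eqI[of "\<lambda>x. f x * g x" "f x *\<^sub>R grad g x + g x *\<^sub>R grad f x" x i]
    has_derivative_mult[OF has_derivative_grad[OF assms(1)] has_derivative_grad[OF assms(2)]]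
  by (simp add: inner_add_left grad_def mult.commute)

lemma partial_const: "partial i (\<lambda>x. c) x = 0"
  by (simp add: partial_def)

lemma partial_sum:
  assumes "finite I" "\<And>j. j \<in> I \<Longrightarrow> f j differentiable (at x)"
  shows "partial i (\<lambda>x. \<Sum>j\<in>I. f j x) x = (\<Sum>j\<in>I. partial i (f j) x)"
  using assms
proof (induction I rule: finite_induct)
  case (insert j J)
  have "(\<lambda>x. \<Sum>j\<in>J. f j x) differentiable (at x)"
    using insert by (intro differentiable_sum) auto
  then show ?case using insert by (simp add: partial_add)
qed (simp add: partial_const)

lemma diff_upto_add:
  assumes "open U" "diff_upto n U f" "diff_upto n U g"
  shows "diff_upto n U (\<lambda>x. f x + g x)"
  using assms(2,3)
proof (induction n arbitrary: f g)
  case (Suc n f g)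
  have "diff_upto n U (partial i (\<lambda>x. f x + g x))" for i
    by (rule diff_upto_cong[OF assms(1) _ Suc.IH[of "partial i f" "partial i g"]])
      (use Suc.prems in \<open>auto simp: diff_upto_Suc partial_add\<close>)
  then show ?case using Suc.prems by (simp add: diff_upto_Suc)
qed (simp add: diff_upto_0)

lemma diff_upto_mono: "diff_upto n U f \<Longrightarrow> m \<le> n \<Longrightarrow> diff_upto m U f"
  by (auto simp: diff_upto_def)

lemma diff_upto_mult:
  assumes "open U" "diff_upto n U f" "diff_upto n U g"
  shows "diff_upto n U (\<lambda>x. f x * g x)"
  using assms(2,3)
proof (induction n arbitrary: f g)
  case (Suc n f g)
  have fg: "diff_upto n U f" "diff_upto n U g"
    using Suc.prems diff_upto_mono[of "Suc n" _ _ n] by auto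
  have "diff_upto n U (partial i (\<lambda>x. f x * g x))" for i
    by (rule diff_upto_cong[OF assms(1) _ diff_upto_add[OF assms(1)
            Suc.IH[of f "partial i g"] Suc.IH[of "partial i f" g]]])
      (use Suc.prems fg in \<open>auto simp: diff_upto_Suc partial_mult\<close>)
  then show ?case using Suc.prems by (simp add: diff_upto_Suc)
qed (simp add: diff_upto_0)

lemma smooth_on_const:
  fixes U :: "(real^'d::finite) set"
  shows "smooth_on U (\<lambda>x. c)"
proof -
  have "diff_upto n U (\<lambda>x. c)" for n c
  proof (induction n arbitrary: c)
    case (Suc n)
    have "partial i (\<lambda>x. c) = (\<lambda>x. 0)" for i :: 'd by (simp add: partial_const fun_eq_iff)
    then show ?case using Suc by (simp add: diff_upto_Suc)
  qed (simp add: diff_upto_0)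
  then show ?thesis by (simp add: smooth_on_iff_diff_upto)
qed

lemma smooth_on_add: "open U \<Longrightarrow> smooth_on U f \<Longrightarrow> smooth_on U g \<Longrightarrow> smooth_on U (\<lambda>x. f x + g x)"
  by (simp add: smooth_on_iff_diff_upto diff_upto_add)

lemma smooth_on_mult: "open U \<Longrightarrow> smooth_on U f \<Longrightarrow> smooth_on U g \<Longrightarrow> smooth_on U (\<lambda>x. f x * g x)"
  by (simp add: smooth_on_iff_diff_upto diff_upto_mult)

lemma smooth_on_sum:
  "finite I \<Longrightarrow> open U \<Longrightarrow> (\<And>j. j \<in> I \<Longrightarrow> smooth_on U (f j)) \<Longrightarrow> smooth_on U (\<lambda>x. \<Sum>j\<in>I. f j x)"
  by (induction I rule: finite_induct) (auto simp: smooth_on_const smooth_on_add)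

lemma smooth_on_partial: "smooth_on U f \<Longrightarrow> smooth_on U (partial i f)"
  by (simp add: smooth_on_def partials_snoc[symmetric])

lemma smooth_on_imp_differentiable: "smooth_on U f \<Longrightarrow> x \<in> U \<Longrightarrow> f differentiable (at x)"
  unfolding smooth_on_def by (metis partials.simps(1))

text \<open>\<open>normal_coeff \<phi> k is\<close> is the coefficient of \<open>partials is w\<close> in the \<open>k\<close>-fold normal derivative of \<open>w\<close>. The
  recursion is the product rule: the gradient falls either on the coefficient or on the derivative of
  \<open>w\<close>, in which case it prepends a direction.\<close>

fun normal_coeff :: "(real^'d::finite \<Rightarrow> real) \<Rightarrow> nat \<Rightarrow> 'd list \<Rightarrow> real^'d \<Rightarrow> real" where
  "normal_coeff \<phi> 0 is = (\<lambda>x. if is = [] then 1 else 0)"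
| "normal_coeff \<phi> (Suc k) is = (\<lambda>x. (\<Sum>i\<in>UNIV. partial i \<phi> x * partial i (normal_coeff \<phi> k is) x)
     + (case is of [] \<Rightarrow> 0 | i # js \<Rightarrow> partial i \<phi> x * normal_coeff \<phi> k js x))"

lemma smooth_on_normal_coeff:
  assumes "open U" "smooth_on U \<phi>"
  shows "smooth_on U (normal_coeff \<phi> k is)"
proof (induction k arbitrary: "is")
  case 0
  then show ?case by (simp add: smooth_on_const)
next
  case (Suc k)
  have "smooth_on U (\<lambda>x. case is of [] \<Rightarrow> 0 | i # js \<Rightarrow> partial i \<phi> x * normal_coeff \<phi> k js x)"
    by (cases "is") (use assms Suc in \<open>auto intro: smooth_on_const smooth_on_mult smooth_on_partial\<close>)
  then show ?case
    unfolding normal_coeff.simps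
    using assms Suc by (intro smooth_on_add smooth_on_sum smooth_on_mult smooth_on_partial) auto
qed

lemma normal_coeff_eq_0: "k < length is \<Longrightarrow> normal_coeff \<phi> k is = (\<lambda>x. 0)"
proof (induction k arbitrary: "is")
  case (Suc k)
  then show ?case by (cases "is") (auto simp: partial_const)
qed auto

lemma normal_coeff_top: "length is = k \<Longrightarrow> normal_coeff \<phi> k is x = prod_list (map (\<lambda>i. partial i \<phi> x) is)"
proof (induction k arbitrary: "is")
  case (Suc k)
  then show ?case by (cases "is") (auto simp: normal_coeff_eq_0 partial_const)
qed auto

lemma finite_lists_upto: "finite {is :: 'd::finite list. length is \<le> k}"
  using finite_lists_length_le[of "UNIV :: 'd set" k] by simp

lemma sum_lists_upto_Suc:
  fixes f :: "'d::finite list \<Rightarrow> real"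
  shows "(\<Sum>is | length is \<le> Suc k. f is) = f [] + (\<Sum>is | length is \<le> k. \<Sum>i\<in>UNIV. f (i # is))"
proof -
  let ?g = "\<lambda>(is, i). (i :: 'd) # is"
  let ?S = "{is :: 'd list. length is \<le> k} \<times> (UNIV :: 'd set)"
  have set: "{is :: 'd list. length is \<le> Suc k} = insert [] (?g ` ?S)"
  proof (intro equalityI subsetI)
    fix xs :: "'d list" assume "xs \<in> {is. length is \<le> Suc k}"
    then show "xs \<in> insert [] (?g ` ?S)" by (cases xs) (auto simp: image_iff)
  qed auto
  have "inj_on ?g ?S" by (auto simp: inj_on_def)
  then have "(\<Sum>is\<in>?g ` ?S. f is) = (\<Sum>p\<in>?S. f (?g p))" by (simp add: sum.reindex)
  also have "\<dots> = (\<Sum>is | length is \<le> k. \<Sum>i\<in>UNIV. f (i # is))"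
    by (simp add: sum.cartesian_product case_prod_beta)
  finally have "(\<Sum>is\<in>?g ` ?S. f is) = (\<Sum>is | length is \<le> k. \<Sum>i\<in>UNIV. f (i # is))" .
  moreover have "finite (?g ` ?S)" using finite_lists_upto by (intro finite_imageI finite_cartesian_product) auto
  moreover have "[] \<notin> ?g ` ?S" by auto
  ultimately show ?thesis unfolding set by (simp add: sum.insert)
qed

lemma normal_deriv_expansion:
  assumes "open V" "smooth_on V \<phi>"
  shows "(\<And>is x. length is < k \<Longrightarrow> x \<in> V \<Longrightarrow> partials is w differentiable (at x)) \<Longrightarrow> x \<in> V \<Longrightarrow>
    (normal_deriv \<phi> ^^ k) w x = (\<Sum>is | length is \<le> k. normal_coeff \<phi> k is x * partials is w x)"
proof (induction k arbitrary: x)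
  case 0
  have "{is :: 'a list. length is \<le> 0} = {[]}" by auto
  then show ?case by simp
next
  case (Suc k)
  let ?c = "normal_coeff \<phi> k"
  let ?A = "{is :: 'a list. length is \<le> k}"
  have fin: "finite ?A" by (rule finite_lists_upto)
  have c: "?c is differentiable (at x)" for "is"
    using smooth_on_normal_coeff[OF assms] Suc.prems(2) by (rule smooth_on_imp_differentiable)
  have w: "partials is w differentiable (at x)" if "length is \<le> k" for "is"
    using Suc.prems that by simp
  have "partial i ((normal_deriv \<phi> ^^ k) w) x
      = (\<Sum>is\<in>?A. ?c is x * partials (i # is) w x + partial i (?c is) x * partials is w x)" for i
  proof -
    have "partial i ((normal_deriv \<phi> ^^ k) w) x
        = partial i (\<lambda>x. \<Sum>is\<in>?A. ?c is x * partials is w x) x"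
      by (rule partial_cong_open[OF assms(1) Suc.prems(2) Suc.IH]) (use Suc.prems in auto)
    also have "\<dots> = (\<Sum>is\<in>?A. partial i (\<lambda>x. ?c is x * partials is w x) x)"
      by (rule partial_sum[OF fin]) (use c w in \<open>auto intro!: differentiable_mult\<close>)
    also have "\<dots> = (\<Sum>is\<in>?A. ?c is x * partials (i # is) w x + partial i (?c is) x * partials is w x)"
      by (rule sum.cong) (use c w in \<open>auto simp: partial_mult\<close>)
    finally show ?thesis .
  qed
  then have "(normal_deriv \<phi> ^^ Suc k) w x = (\<Sum>i\<in>UNIV. (\<Sum>is\<in>?A. ?c is x * partials (i # is) w x
      + partial i (?c is) x * partials is w x) * partial i \<phi> x)"
    by (simp add: normal_deriv_def grad_def inner_vec_def)
  also have "\<dots> = (\<Sum>is\<in>?A. \<Sum>i\<in>UNIV. partial i \<phi> x * ?c is x * partials (i # is) w x)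
      + (\<Sum>is\<in>?A. (\<Sum>i\<in>UNIV. partial i \<phi> x * partial i (?c is) x) * partials is w x)"
    unfolding sum_distrib_right
    by (subst sum.swap) (simp add: sum.distrib[symmetric] algebra_simps)
  also have "(\<Sum>is\<in>?A. (\<Sum>i\<in>UNIV. partial i \<phi> x * partial i (?c is) x) * partials is w x)
      = (\<Sum>is | length is \<le> Suc k. (\<Sum>i\<in>UNIV. partial i \<phi> x * partial i (?c is) x) * partials is w x)"
    by (rule sum.mono_neutral_left[OF finite_lists_upto])
      (auto simp: normal_coeff_eq_0 partial_const le_Suc_eq)
  also have "(\<Sum>is\<in>?A. \<Sum>i\<in>UNIV. partial i \<phi> x * ?c is x * partials (i # is) w x)
      = (\<Sum>is | length is \<le> Suc k.
          (case is of [] \<Rightarrow> 0 | i # js \<Rightarrow> partial i \<phi> x * ?c js x) * partials is w x)"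
    by (simp add: sum_lists_upto_Suc del: partials.simps)
  finally show ?case
    by (simp add: sum.distrib[symmetric] distrib_right add.commute)
qed

section \<open>Agreement of traces and gluing\<close>

lemma has_derivative_within_Un:
  assumes "(f has_derivative f') (at x within S)" "(f has_derivative f') (at x within T)"
  shows "(f has_derivative f') (at x within S \<union> T)"
  using assms by (simp add: has_derivative_iff_norm Lim_within_Un)

context regular_level_set
begin

lemma jet_rotate_nonneg:
  assumes "jet_on q pos P" "\<And>is. length is \<le> q \<Longrightarrow> continuous_on nonneg (P is)"
    and "y \<in> nonneg" "length as + length bs < q"
  shows "P (i # as @ bs) y = P (as @ i # bs) y"
  by (rule eq_on_limit_points[OF nonneg_subset_closure, of "P (i # as @ bs)" "P (as @ i # bs)"])
    (use assms jet_on_rotate[OF open_sides(1) assms(1)] in \<open>auto simp: side_defs\<close>)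

lemma jet_rotate_nonpos:
  assumes "jet_on q neg P" "\<And>is. length is \<le> q \<Longrightarrow> continuous_on nonpos (P is)"
    and "y \<in> nonpos" "length as + length bs < q"
  shows "P (i # as @ bs) y = P (as @ i # bs) y"
  by (rule eq_on_limit_points[OF nonpos_subset_closure, of "P (i # as @ bs)" "P (as @ i # bs)"])
    (use assms jet_on_rotate[OF open_sides(2) assms(1)] in \<open>auto simp: side_defs\<close>)

text \<open>If the combinations of jumps that come from the normal derivatives vanish for all orders up to \<open>q\<close>,
  then all jumps vanish.\<close>

lemma traces_agree:
  assumes P: "jet_on q pos P" "\<And>is. length is \<le> q \<Longrightarrow> continuous_on nonneg (P is)"
    and M: "jet_on q neg M" "\<And>is. length is \<le> q \<Longrightarrow> continuous_on nonpos (M is)"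
    and normal: "\<And>k x. k \<le> q \<Longrightarrow> x \<in> B \<Longrightarrow> \<phi> x = 0 \<Longrightarrow>
      (\<Sum>is | length is \<le> k. normal_coeff \<phi> k is x * (P is x - M is x)) = 0"
  shows "length is \<le> q \<Longrightarrow> x \<in> B \<Longrightarrow> \<phi> x = 0 \<Longrightarrow> P is x = M is x"
proof (induction "length is" arbitrary: "is" x rule: less_induct)
  case (less "is" x)
  define k where "k = length is"
  define F where "F = (\<lambda>is y. P is y - M is y)"
  define n where "n = (\<lambda>i. partial i \<phi> x)"
  have kq: "k \<le> q" and x: "x \<in> B" "\<phi> x = 0" using less.prems by (auto simp: k_def)
  have F0: "F js y = 0" if "length js < k" "y \<in> B" "\<phi> y = 0" for js y
    using less.hyps[of js y] that kq by (simp add: F_def k_def)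
  have "grad \<phi> x \<noteq> 0" using regular x by simp
  then obtain i0 where i0: "n i0 \<noteq> 0" by (auto simp: vec_eq_iff grad_def n_def)
  \<comment> \<open>Jumps of order \<open>k - 1\<close> vanish on the zero set, so the jump of their gradient is normal.\<close>
  have tang: "n i0 * F (i # js) x = n i * F (i0 # js) x" if "Suc (length js) = k" for i js
  proof -
    have js: "length js < q" using that kq by simp
    have x': "x \<in> nonneg" "x \<in> nonpos" using x by (auto simp: side_defs)
    have sub: "{y\<in>B. \<phi> y = 0} \<subseteq> nonneg" "{y\<in>B. \<phi> y = 0} \<subseteq> nonpos" by (auto simp: side_defs)
    have "(F js has_derivative (\<lambda>h. (\<chi> i. P (i # js) x) \<bullet> h - (\<chi> i. M (i # js) x) \<bullet> h))
        (at x within {y\<in>B. \<phi> y = 0})"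
      unfolding F_def
      using has_derivative_subset[OF jet_has_derivative_nonneg[OF P x js] sub(1)]
        has_derivative_subset[OF jet_has_derivative_nonpos[OF M x js] sub(2)]
      by (rule has_derivative_diff)
    moreover have "(\<chi> i. F (i # js) x) = (\<chi> i. P (i # js) x) - (\<chi> i. M (i # js) x)"
      by (simp add: F_def vec_eq_iff)
    ultimately have "(F js has_derivative (\<lambda>h. (\<chi> i. F (i # js) x) \<bullet> h)) (at x within {y\<in>B. \<phi> y = 0})"
      by (simp add: inner_diff_left)
    moreover have "grad \<phi> x \<bullet> (n i0 *\<^sub>R axis i 1 - n i *\<^sub>R axis i0 1) = 0"
      by (simp add: inner_diff_right inner_axis grad_def n_def)
    ultimately have "(\<chi> i. F (i # js) x) \<bullet> (n i0 *\<^sub>R axis i 1 - n i *\<^sub>R axis i0 1) = 0"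
      using tangential_derivative_zero[OF x, of "F js"] F0 that by auto
    then show ?thesis by (simp add: inner_diff_right inner_axis)
  qed
  have rot: "F (i # as @ bs) x = F (as @ i # bs) x" if "Suc (length as + length bs) = k" for i as bs
    using jet_rotate_nonneg[OF P, of x as bs i] jet_rotate_nonpos[OF M, of x as bs i] that kq x
    by (simp add: F_def side_defs)
  \<comment> \<open>Every entry of the jump of order \<open>k\<close> is therefore a multiple of one of them.\<close>
  have factor: "F (as @ replicate r i0) x * n i0 ^ length as
      = prod_list (map n as) * F (replicate k i0) x" if "length as + r = k" for as r
    using that
  proof (induction as arbitrary: r)
    case (Cons a as)
    have "F ((a # as) @ replicate r i0) x * n i0 ^ length (a # as)
        = (n i0 * F (a # as @ replicate r i0) x) * n i0 ^ length as" by simp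
    also have "\<dots> = n a * (F (i0 # as @ replicate r i0) x * n i0 ^ length as)"
      using tang[of "as @ replicate r i0" a] Cons.prems by simp
    also have "F (i0 # as @ replicate r i0) x = F (as @ replicate (Suc r) i0) x"
      using rot[of as "replicate r i0" i0] Cons.prems by simp
    also have "n a * (F (as @ replicate (Suc r) i0) x * n i0 ^ length as)
        = n a * (prod_list (map n as) * F (replicate k i0) x)"
      using Cons.IH[of "Suc r"] Cons.prems by simp
    finally show ?case by simp
  qed simp
  have factor': "F js x * n i0 ^ k = prod_list (map n js) * F (replicate k i0) x" if "length js = k" for js
    using factor[of js 0] that by simp
  let ?K = "{js :: 'd list. length js = k}"
  have fin: "finite ?K"
    using finite_subset[OF _ finite_lists_upto[of k], of ?K] by auto
  have "0 = (\<Sum>js | length js \<le> k. normal_coeff \<phi> k js x * F js x)"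
    using normal[OF kq x] by (simp add: F_def)
  also have "\<dots> = (\<Sum>js\<in>?K. normal_coeff \<phi> k js x * F js x)"
    by (rule sum.mono_neutral_right[OF finite_lists_upto]) (auto simp: F0 x)
  also have "\<dots> = (\<Sum>js\<in>?K. prod_list (map n js) * F js x)"
    by (rule sum.cong) (auto simp: normal_coeff_top n_def)
  finally have "0 = (\<Sum>js\<in>?K. prod_list (map n js) * F js x) * n i0 ^ k" by simp
  also have "\<dots> = (\<Sum>js\<in>?K. prod_list (map n js) * (F js x * n i0 ^ k))"
    by (simp add: sum_distrib_right mult.assoc)
  also have "\<dots> = (\<Sum>js\<in>?K. (prod_list (map n js))\<^sup>2 * F (replicate k i0) x)"
    by (rule sum.cong) (auto simp: factor' power2_eq_square)
  finally have "(\<Sum>js\<in>?K. (prod_list (map n js))\<^sup>2) * F (replicate k i0) x = 0"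
    by (simp add: sum_distrib_right)
  moreover have "(\<Sum>js\<in>?K. (prod_list (map n js))\<^sup>2) > 0"
  proof -
    have "0 < (prod_list (map n (replicate k i0)))\<^sup>2" using i0 by simp
    also have "\<dots> \<le> (\<Sum>js\<in>?K. (prod_list (map n js))\<^sup>2)"
      by (rule member_le_sum) (use fin in auto)
    finally show ?thesis .
  qed
  ultimately have "F (replicate k i0) x = 0" by simp
  then have "F is x * n i0 ^ k = 0" using factor'[of "is"] by (simp add: k_def)
  then show ?case using i0 by (simp add: F_def)
qed

text \<open>The family that is \<open>P\<close> where \<open>\<phi> \<ge> 0\<close>, including the zero set, and \<open>M\<close> elsewhere.\<close>

definition glue :: "('d list \<Rightarrow> real^'d \<Rightarrow> real) \<Rightarrow> ('d list \<Rightarrow> real^'d \<Rightarrow> real) \<Rightarrow> 'd list \<Rightarrow> real^'d \<Rightarrow> real"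
  where "glue P M is y = (if \<phi> y \<ge> 0 then P is y else M is y)"

lemma jet_on_glue:
  assumes P: "jet_on q pos P" "\<And>is. length is \<le> q \<Longrightarrow> continuous_on nonneg (P is)"
    and M: "jet_on q neg M" "\<And>is. length is \<le> q \<Longrightarrow> continuous_on nonpos (M is)"
    and eq: "\<And>is x. length is \<le> q \<Longrightarrow> x \<in> B \<Longrightarrow> \<phi> x = 0 \<Longrightarrow> P is x = M is x"
  shows "jet_on q B (glue P M)"
  unfolding jet_on_def
proof (intro allI impI ballI)
  fix "is" :: "'d list" and y assume l: "length is < q" and y: "y \<in> B"
  consider "\<phi> y > 0" | "\<phi> y < 0" | "\<phi> y = 0" by linarith
  then show "(glue P M is has_derivative (\<lambda>h. (\<chi> i. glue P M (i # is) y) \<bullet> h)) (at y)"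
  proof cases
    case 1
    then have "y \<in> pos" using y by (simp add: pos_def)
    moreover have "P is z = glue P M is z" if "z \<in> pos" for z
      using that by (simp add: glue_def pos_def)
    ultimately have "(glue P M is has_derivative (\<lambda>h. (\<chi> i. P (i # is) y) \<bullet> h)) (at y)"
      using has_derivative_transform_within_open[OF jet_onD[OF P(1) l] open_sides(1)] by blast
    moreover have "(\<chi> i. glue P M (i # is) y) = (\<chi> i. P (i # is) y)"
      using 1 by (simp add: glue_def)
    ultimately show ?thesis by simp
  next
    case 2
    then have "y \<in> neg" using y by (simp add: neg_def)
    moreover have "M is z = glue P M is z" if "z \<in> neg" for z
      using that by (simp add: glue_def neg_def)
    ultimately have "(glue P M is has_derivative (\<lambda>h. (\<chi> i. M (i # is) y) \<bullet> h)) (at y)"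
      using has_derivative_transform_within_open[OF jet_onD[OF M(1) l] open_sides(2)] by blast
    moreover have "(\<chi> i. glue P M (i # is) y) = (\<chi> i. M (i # is) y)"
      using 2 by (simp add: glue_def)
    ultimately show ?thesis by simp
  next
    case 3
    have y': "y \<in> nonneg" "y \<in> nonpos" using y 3 by (auto simp: side_defs)
    have val: "glue P M (i # is) y = P (i # is) y" "P (i # is) y = M (i # is) y" for i
      using 3 eq[OF _ y 3, of "i # is"] l by (simp_all add: glue_def)
    have g: "(\<chi> i. glue P M (i # is) y) = (\<chi> i. P (i # is) y)"
      "(\<chi> i. glue P M (i # is) y) = (\<chi> i. M (i # is) y)"
      by (simp_all only: val)
    have P_eq: "glue P M is z = P is z" if "z \<in> nonneg" for z
      using that by (simp add: glue_def nonneg_def)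
    have M_eq: "glue P M is z = M is z" if "z \<in> nonpos" for z
      using that eq[of "is" z] l by (simp add: glue_def nonpos_def)
    have "(glue P M is has_derivative (\<lambda>h. (\<chi> i. glue P M (i # is) y) \<bullet> h)) (at y within nonneg)"
      unfolding g(1)
      by (rule has_derivative_transform[OF y'(1) P_eq jet_has_derivative_nonneg[OF P y 3 l]])
    moreover have "(glue P M is has_derivative (\<lambda>h. (\<chi> i. glue P M (i # is) y) \<bullet> h)) (at y within nonpos)"
      unfolding g(2)
      by (rule has_derivative_transform[OF y'(2) M_eq jet_has_derivative_nonpos[OF M y 3 l]])
    ultimately have "(glue P M is has_derivative (\<lambda>h. (\<chi> i. glue P M (i # is) y) \<bullet> h))
        (at y within nonneg \<union> nonpos)"
      by (rule has_derivative_within_Un)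
    moreover have "nonneg \<union> nonpos = B" by (auto simp: side_defs)
    ultimately show ?thesis
      by (simp only: at_within_open[OF y open_B])
  qed
qed

text \<open>Convexity of \<open>U\<close> keeps the constant: a segment between the two sides meets the zero set
  inside \<open>U\<close>, and lengths add up along it.\<close>

lemma lipschitz_on_glue:
  assumes "convex U" "U \<subseteq> B"
    and P: "L-lipschitz_on (U \<inter> nonneg) (P is)" and M: "L-lipschitz_on (U \<inter> nonpos) (M is)"
    and eq: "\<And>x. x \<in> B \<Longrightarrow> \<phi> x = 0 \<Longrightarrow> P is x = M is x"
  shows "L-lipschitz_on U (glue P M is)"
proof (rule lipschitz_onI)
  show "0 \<le> L" using P lipschitz_on_nonneg by blast
  have same: "dist (glue P M is y) (glue P M is z) \<le> L * dist y z"
    if "y \<in> U" "z \<in> U" "\<phi> y \<ge> 0 \<and> \<phi> z \<ge> 0 \<or> \<phi> y \<le> 0 \<and> \<phi> z \<le> 0" for y z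
  proof (cases "\<phi> y \<ge> 0 \<and> \<phi> z \<ge> 0")
    case True
    then show ?thesis
      using lipschitz_onD[OF P, of y z] that assms(2) by (auto simp: glue_def nonneg_def)
  next
    case False
    then have le: "\<phi> y \<le> 0" "\<phi> z \<le> 0" using that(3) by auto
    then have "glue P M is y = M is y" "glue P M is z = M is z"
      using eq that assms(2) by (auto simp: glue_def)
    then show ?thesis
      using lipschitz_onD[OF M, of y z] that assms(2) le by (auto simp: nonpos_def)
  qed
  have crossing: "dist (glue P M is y) (glue P M is z) \<le> L * dist y z"
    if "y \<in> U" "z \<in> U" "\<phi> y < 0" "\<phi> z > 0" for y z
  proof -
    have seg: "closed_segment y z \<subseteq> U" using that assms(1) by (simp add: closed_segment_subset)
    have "connected (\<phi> ` closed_segment y z)"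
      using seg assms(2)
      by (intro connected_continuous_image continuous_on_subset[OF continuous_on_phi]) auto
    moreover have "\<phi> y \<in> \<phi> ` closed_segment y z" "\<phi> z \<in> \<phi> ` closed_segment y z" by auto
    ultimately have "0 \<in> \<phi> ` closed_segment y z"
      using connectedD_interval[of "\<phi> ` closed_segment y z" "\<phi> y" "\<phi> z" 0] that by simp
    then obtain c where c: "c \<in> closed_segment y z" "\<phi> c = 0" by auto
    have "dist (glue P M is y) (glue P M is z)
        \<le> dist (glue P M is y) (glue P M is c) + dist (glue P M is c) (glue P M is z)"
      by (rule dist_triangle)
    also have "\<dots> \<le> L * dist y c + L * dist c z"
      using same[of y c] same[of c z] c seg that by (intro add_mono) auto
    also have "\<dots> = L * dist y z"
    proof -
      have "dist y z = dist y c + dist c z"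
        using c(1) between[of y z c] by (simp add: between_mem_segment)
      then show ?thesis by (simp add: distrib_left)
    qed
    finally show ?thesis .
  qed
  show "dist (glue P M is y) (glue P M is z) \<le> L * dist y z" if "y \<in> U" "z \<in> U" for y z
  proof -
    consider "\<phi> y \<ge> 0 \<and> \<phi> z \<ge> 0 \<or> \<phi> y \<le> 0 \<and> \<phi> z \<le> 0" | "\<phi> y < 0" "\<phi> z > 0" | "\<phi> z < 0" "\<phi> y > 0"
      by linarith
    then show ?thesis
      using same[OF that] crossing[OF that] crossing[OF that(2,1)]
      by cases (simp_all add: dist_commute)
  qed
qed

end

section \<open>The signed distance function\<close>

lemma signed_dist_sign:
  assumes "bounds_region \<Gamma> R" "\<Gamma> \<noteq> {}"
  shows "signed_dist \<Gamma> R x > 0 \<longleftrightarrow> x \<in> R"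
    and "signed_dist \<Gamma> R x = 0 \<longleftrightarrow> x \<in> \<Gamma>"
    and "signed_dist \<Gamma> R x < 0 \<longleftrightarrow> x \<notin> closure R"
    and "\<bar>signed_dist \<Gamma> R x\<bar> = infdist x \<Gamma>"
proof -
  have R: "open R" "frontier R = \<Gamma>" using assms(1) by (auto simp: bounds_region_def)
  have cl: "closed \<Gamma>" using R(2) frontier_closed by blast
  have disj: "R \<inter> \<Gamma> = {}" using R by (auto simp: frontier_def interior_open)
  have clR: "closure R = R \<union> \<Gamma>" using R closure_Un_frontier by blast
  have z: "infdist x \<Gamma> = 0 \<longleftrightarrow> x \<in> \<Gamma>" using in_closed_iff_infdist_zero[OF cl assms(2)] by blast
  have nn: "infdist x \<Gamma> \<ge> 0" by (rule infdist_nonneg)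
  show "signed_dist \<Gamma> R x > 0 \<longleftrightarrow> x \<in> R" "signed_dist \<Gamma> R x = 0 \<longleftrightarrow> x \<in> \<Gamma>"
    "signed_dist \<Gamma> R x < 0 \<longleftrightarrow> x \<notin> closure R" "\<bar>signed_dist \<Gamma> R x\<bar> = infdist x \<Gamma>"
    using z nn disj clR by (auto simp: signed_dist_def less_le)
qed

lemma grad_signed_dist_nonzero:
  assumes R: "bounds_region \<Gamma> R" and "\<Gamma> \<noteq> {}"
    and "open B" "smooth_on B (signed_dist \<Gamma> R)" "x \<in> B" "x \<in> \<Gamma>"
  shows "grad (signed_dist \<Gamma> R) x \<noteq> 0"
proof -
  define \<phi> where "\<phi> = signed_dist \<Gamma> R"
  note sign = signed_dist_sign[OF R \<open>\<Gamma> \<noteq> {}\<close>, folded \<phi>_def]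
  have cl: "closed \<Gamma>" using R frontier_closed by (auto simp: bounds_region_def)
  have \<phi>': "(\<phi> has_derivative (\<lambda>h. grad \<phi> y \<bullet> h)) (at y)" if "y \<in> B" for y
    unfolding \<phi>_def by (rule has_derivative_grad[OF smooth_on_imp_differentiable[OF assms(4) that]])
  \<comment> \<open>Moving from \<open>y \<in> R\<close> straight to a nearest point of \<open>\<Gamma>\<close> decreases \<open>\<phi>\<close> at unit rate.\<close>
  have ge1: "norm (grad \<phi> y) \<ge> 1" if y: "y \<in> B" "y \<in> R" for y
  proof -
    obtain p where p: "p \<in> \<Gamma>" "infdist y \<Gamma> = dist y p"
      using infdist_attains_inf[OF cl \<open>\<Gamma> \<noteq> {}\<close>] by blast
    define d where "d = dist y p"
    have d: "d > 0" using sign(1)[of y] sign(2)[of y] sign(4)[of y] p y by (auto simp: d_def)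
    define e where "e = (1 / d) *\<^sub>R (p - y)"
    have e: "norm e = 1" using d by (simp add: e_def d_def dist_norm norm_minus_commute)
    have p_eq: "p = y + d *\<^sub>R e" using d by (simp add: e_def)
    have \<phi>y: "\<phi> y = d" using sign(1)[of y] sign(4)[of y] p y by (simp add: d_def)
    have dec: "\<phi> (y + t *\<^sub>R e) \<le> d - t" if "t \<le> d" for t
    proof -
      have "\<phi> (y + t *\<^sub>R e) \<le> infdist (y + t *\<^sub>R e) \<Gamma>" using sign(4)[of "y + t *\<^sub>R e"] by linarith
      also have "\<dots> \<le> dist (y + t *\<^sub>R e) p" using p(1) by (rule infdist_le)
      also have "\<dots> = norm ((t - d) *\<^sub>R e)" by (simp add: p_eq dist_norm algebra_simps)
      also have "\<dots> = d - t" using e that by simp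
      finally show ?thesis .
    qed
    have der: "((\<lambda>t. \<phi> (y + t *\<^sub>R e)) has_real_derivative grad \<phi> y \<bullet> e) (at 0)"
    proof -
      have 1: "((\<lambda>t. y + t *\<^sub>R e) has_derivative (\<lambda>t. t *\<^sub>R e)) (at 0)"
        by (auto intro!: derivative_eq_intros)
      have "(\<phi> has_derivative (\<lambda>h. grad \<phi> y \<bullet> h)) (at (y + 0 *\<^sub>R e))" using \<phi>'[OF y(1)] by simp
      from has_derivative_compose[OF 1 this]
      have "((\<lambda>t. \<phi> (y + t *\<^sub>R e)) has_derivative (\<lambda>t. grad \<phi> y \<bullet> (t *\<^sub>R e))) (at 0)" .
      moreover have "(\<lambda>t. grad \<phi> y \<bullet> (t *\<^sub>R e)) = (*) (grad \<phi> y \<bullet> e)" by (simp add: fun_eq_iff)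
      ultimately show ?thesis by (simp only: has_field_derivative_def)
    qed
    have "((\<lambda>t. \<phi> (y + t *\<^sub>R e) + t) has_real_derivative grad \<phi> y \<bullet> e + 1) (at 0)"
      by (intro derivative_intros der)
    have "grad \<phi> y \<bullet> e + 1 \<le> 0"
    proof (rule ccontr)
      assume "\<not> grad \<phi> y \<bullet> e + 1 \<le> 0"
      then obtain s where s: "s > 0" "\<And>t. 0 < t \<Longrightarrow> t < s \<Longrightarrow> \<phi> (y + t *\<^sub>R e) + t > \<phi> y"
        using DERIV_pos_inc_right[OF \<open>((\<lambda>t. \<phi> (y + t *\<^sub>R e) + t) has_real_derivative _) (at 0)\<close>] by auto
      define t where "t = min s d / 2"
      have "0 < t" "t < s" "t \<le> d" using s(1) d by (auto simp: t_def)
      then show False using s(2)[of t] dec[of t] \<phi>y by simp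
    qed
    then have "1 \<le> \<bar>grad \<phi> y \<bullet> e\<bar>" by simp
    also have "\<dots> \<le> norm (grad \<phi> y) * norm e" by (rule Cauchy_Schwarz_ineq2)
    finally show ?thesis using e by simp
  qed
  have "x \<in> closure R" "x \<notin> R" using R \<open>x \<in> \<Gamma>\<close> by (auto simp: bounds_region_def frontier_def interior_open)
  then have "x \<in> closure (B \<inter> R)" "B \<inter> R - {x} = B \<inter> R"
    using open_Int_closure_subset[OF assms(3), of R] assms(5) by auto
  then have nt: "at x within (B \<inter> R) \<noteq> bot"
    by (simp add: at_within_eq_bot_iff)
  have "partial i \<phi> differentiable (at x)" for i
    using smooth_on_imp_differentiable[OF smooth_on_partial[OF assms(4)] assms(5)] by (simp add: \<phi>_def)
  then have "isCont (grad \<phi>) x"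
    unfolding isCont_def
    by (intro vec_tendstoI) (simp add: grad_def isCont_def[symmetric] differentiable_imp_continuous_within)
  then have "((\<lambda>y. norm (grad \<phi> y)) \<longlongrightarrow> norm (grad \<phi> x)) (at x within (B \<inter> R))"
    unfolding isCont_def by (rule tendsto_norm[OF tendsto_within_subset[OF _ subset_UNIV]])
  moreover have "\<forall>\<^sub>F y in at x within (B \<inter> R). 1 \<le> norm (grad \<phi> y)"
    using ge1 by (auto simp: eventually_at_filter)
  ultimately have "1 \<le> norm (grad \<phi> x)"
    using tendsto_lowerbound nt by blast
  then show ?thesis unfolding \<phi>_def[symmetric] by auto
qed

section \<open>Removing the jump of a piecewise smooth function\<close>

lemma LC_with_subset: "LC_with k \<Lambda> A f \<Longrightarrow> A' \<subseteq> A \<Longrightarrow> LC_with k \<Lambda> A' f"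
  unfolding LC_with_def by (meson lipschitz_on_subset subsetD)

lemma LC_with_extend_closure:
  assumes "LC_with q \<Lambda> A f"
  obtains P where "\<And>is. length is \<le> q \<Longrightarrow> (\<Lambda> (length is))-lipschitz_on (closure A) (P is)"
    and "\<And>is x. length is \<le> q \<Longrightarrow> x \<in> A \<Longrightarrow> P is x = partials is f x"
proof -
  have "\<exists>g. length is \<le> q \<longrightarrow> (\<Lambda> (length is))-lipschitz_on (closure A) g
      \<and> (\<forall>x\<in>A. g x = partials is f x)" for "is"
    using assms lipschitz_extend_closure unfolding LC_with_def by blast
  then obtain P where "\<forall>is. length is \<le> q \<longrightarrow> (\<Lambda> (length is))-lipschitz_on (closure A) (P is)
      \<and> (\<forall>x\<in>A. P is x = partials is f x)" by metis
  then show thesis using that by blast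
qed

context regular_level_set
begin

lemma tendsto_iterated_normal_deriv:
  assumes A: "open A" "A \<subseteq> B" "A \<subseteq> S" and f: "LC_with q \<Lambda> A f" and "k \<le> q"
    and P: "\<And>is. length is \<le> q \<Longrightarrow> continuous_on S (P is)"
      "\<And>is y. length is \<le> q \<Longrightarrow> y \<in> A \<Longrightarrow> P is y = partials is f y"
    and x: "x \<in> S" "x \<in> B"
  shows "((normal_deriv \<phi> ^^ k) f \<longlongrightarrow> (\<Sum>is | length is \<le> k. normal_coeff \<phi> k is x * P is x)) (at x within A)"
proof -
  have "((\<lambda>y. \<Sum>is | length is \<le> k. normal_coeff \<phi> k is y * P is y)
      \<longlongrightarrow> (\<Sum>is | length is \<le> k. normal_coeff \<phi> k is x * P is x)) (at x within A)"
  proof (intro tendsto_sum tendsto_mult)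
    fix "is" :: "'d list" assume "is \<in> {is. length is \<le> k}"
    then show "(P is \<longlongrightarrow> P is x) (at x within A)"
      using P(1)[of "is"] x(1) \<open>k \<le> q\<close> tendsto_within_subset[OF _ A(3)] by (auto simp: continuous_on_def)
    have "normal_coeff \<phi> k is differentiable (at x)"
      using smooth_on_imp_differentiable[OF smooth_on_normal_coeff[OF open_B smooth] x(2)] .
    then have "isCont (normal_coeff \<phi> k is) x" by (rule differentiable_imp_continuous_within)
    then show "(normal_coeff \<phi> k is \<longlongrightarrow> normal_coeff \<phi> k is x) (at x within A)"
      unfolding isCont_def by (rule tendsto_within_subset) simp
  qed
  moreover have "(normal_deriv \<phi> ^^ k) f y = (\<Sum>is | length is \<le> k. normal_coeff \<phi> k is y * P is y)"
    if "y \<in> A" for y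
  proof -
    have "smooth_on A \<phi>" using smooth A(2) by (auto simp: smooth_on_def)
    then have "(normal_deriv \<phi> ^^ k) f y = (\<Sum>is | length is \<le> k. normal_coeff \<phi> k is y * partials is f y)"
      using f \<open>k \<le> q\<close> that by (intro normal_deriv_expansion[OF A(1)]) (auto simp: LC_with_def)
    also have "\<dots> = (\<Sum>is | length is \<le> k. normal_coeff \<phi> k is y * P is y)"
      by (rule sum.cong) (use P(2) that \<open>k \<le> q\<close> in auto)
    finally show ?thesis .
  qed
  ultimately show ?thesis by (subst Lim_cong_within) auto
qed

text \<open>\<open>w\<close> continues \<open>u\<close> from the negative side and \<open>w + v\<close> continues it from the positive side across
  the zero set. The bound on the second constant counts \<open>\<Lambda>v\<close> twice because \<open>w + v\<close> is treated as a sum.\<close>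

lemma jump_removal:
  assumes u: "LC_with q \<Lambda>u pos u" "LC_with q \<Lambda>u neg u" and v: "LC_with q \<Lambda>v B v"
    and jump: "\<And>k x. k \<le> q \<Longrightarrow> x \<in> B \<Longrightarrow> \<phi> x = 0 \<Longrightarrow>
      jump \<phi> ((normal_deriv \<phi> ^^ k) u) x = (normal_deriv \<phi> ^^ k) v x"
    and \<Gamma>: "\<And>x. x \<in> B \<Longrightarrow> x \<in> \<Gamma> \<longleftrightarrow> \<phi> x = 0"
    and U: "open U" "convex U" "U \<subseteq> B"
  defines "w \<equiv> \<lambda>x. plus_ext \<Gamma> \<phi> u x - v x * heaviside (\<phi> x)"
  shows "LC_with q (\<lambda>n. \<Lambda>u n + \<Lambda>v n) U w"
    and "LC_with q (\<lambda>n. \<Lambda>u n + \<Lambda>v n + \<Lambda>v n) U (\<lambda>x. w x + v x)"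
    and "\<And>is x. length is \<le> q \<Longrightarrow> x \<in> U \<Longrightarrow> \<phi> x < 0 \<Longrightarrow>
      partials is w x = plus_ext \<Gamma> \<phi> (partials is u) x"
    and "\<And>is x. length is \<le> q \<Longrightarrow> x \<in> U \<Longrightarrow> \<phi> x \<ge> 0 \<Longrightarrow>
      partials is (\<lambda>x. w x + v x) x = plus_ext \<Gamma> \<phi> (partials is u) x"
proof -
  obtain Up where Up: "\<And>is. length is \<le> q \<Longrightarrow> (\<Lambda>u (length is))-lipschitz_on (closure pos) (Up is)"
      "\<And>is x. length is \<le> q \<Longrightarrow> x \<in> pos \<Longrightarrow> Up is x = partials is u x"
    using LC_with_extend_closure[OF u(1)] by blast
  obtain Um where Um: "\<And>is. length is \<le> q \<Longrightarrow> (\<Lambda>u (length is))-lipschitz_on (closure neg) (Um is)"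
      "\<And>is x. length is \<le> q \<Longrightarrow> x \<in> neg \<Longrightarrow> Um is x = partials is u x"
    using LC_with_extend_closure[OF u(2)] by blast
  define P where "P = (\<lambda>is y. Up is y - partials is v y)"
  have sub: "pos \<subseteq> B" "neg \<subseteq> B" "pos \<subseteq> nonneg" "neg \<subseteq> nonpos" "nonneg \<subseteq> B" "nonpos \<subseteq> B"
    by (auto simp: side_defs)
  have lipUp: "(\<Lambda>u (length is))-lipschitz_on nonneg (Up is)" if "length is \<le> q" for "is"
    using Up(1)[OF that] nonneg_subset_closure by (rule lipschitz_on_subset)
  have lipUm: "(\<Lambda>u (length is))-lipschitz_on nonpos (Um is)" if "length is \<le> q" for "is"
    using Um(1)[OF that] nonpos_subset_closure by (rule lipschitz_on_subset)
  have lipv: "(\<Lambda>v (length is))-lipschitz_on B (partials is v)" if "length is \<le> q" for "is"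
    using v that by (simp add: LC_with_def)
  have contUp: "continuous_on nonneg (Up is)" if "length is \<le> q" for "is"
    by (rule lipschitz_on_continuous_on[OF lipUp[OF that]])
  have contM: "continuous_on nonpos (Um is)" if "length is \<le> q" for "is"
    by (rule lipschitz_on_continuous_on[OF lipUm[OF that]])
  have contv: "continuous_on B (partials is v)" if "length is \<le> q" for "is"
    by (rule lipschitz_on_continuous_on[OF lipv[OF that]])
  have contP: "continuous_on nonneg (P is)" if "length is \<le> q" for "is"
    unfolding P_def
    by (intro continuous_on_diff contUp continuous_on_subset[OF contv sub(5)] that)
  have jetUp: "jet_on q pos Up"
    by (rule jet_on_cong[OF open_sides(1) LC_with_jet[OF u(1)]]) (simp add: Up(2))
  have jetM: "jet_on q neg Um"
    by (rule jet_on_cong[OF open_sides(2) LC_with_jet[OF u(2)]]) (simp add: Um(2))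
  have jetv: "jet_on q B (\<lambda>is. partials is v)" by (rule LC_with_jet[OF v])
  have jetP: "jet_on q pos P"
    unfolding P_def by (rule jet_on_diff[OF jetUp jet_on_subset[OF jetv sub(1)]])
  have normal: "(\<Sum>is | length is \<le> k. normal_coeff \<phi> k is x * (P is x - Um is x)) = 0"
    if "k \<le> q" "x \<in> B" "\<phi> x = 0" for k x
  proof -
    have x: "x \<in> nonneg" "x \<in> nonpos" using that by (auto simp: side_defs)
    have "plus_value \<phi> ((normal_deriv \<phi> ^^ k) u) x
        = (\<Sum>is | length is \<le> k. normal_coeff \<phi> k is x * Up is x)"
      by (rule plus_value_eq[OF that(2,3) tendsto_iterated_normal_deriv[OF open_sides(1) sub(1,3)
            u(1) that(1) contUp Up(2) x(1) that(2)]])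
    moreover have "minus_value \<phi> ((normal_deriv \<phi> ^^ k) u) x
        = (\<Sum>is | length is \<le> k. normal_coeff \<phi> k is x * Um is x)"
      by (rule minus_value_eq[OF that(2,3) tendsto_iterated_normal_deriv[OF open_sides(2) sub(2,4)
            u(2) that(1) contM Um(2) x(2) that(2)]])
    moreover have "(normal_deriv \<phi> ^^ k) v x
        = (\<Sum>is | length is \<le> k. normal_coeff \<phi> k is x * partials is v x)"
      using v that(1,2) by (intro normal_deriv_expansion[OF open_B smooth]) (auto simp: LC_with_def)
    ultimately show ?thesis
      using jump[OF that] by (simp add: jump_def P_def sum_subtractf right_diff_distrib)
  qed
  note agree = traces_agree[OF jetP contP jetM contM normal]
  have jetw: "jet_on q U (glue P Um)"
    by (rule jet_on_subset[OF jet_on_glue[OF jetP contP jetM contM agree] U(3)])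
  have trace: "plus_ext \<Gamma> \<phi> (partials is u) x = Up is x"
    if "length is \<le> q" "x \<in> B" "\<phi> x \<ge> 0" for "is" x
  proof (cases "\<phi> x = 0")
    case True
    have "(Up is \<longlongrightarrow> Up is x) (at x within pos)"
      using contUp[OF that(1)] that tendsto_within_subset[OF _ sub(3)]
      by (auto simp: continuous_on_def nonneg_def)
    moreover have "(Up is \<longlongrightarrow> Up is x) (at x within pos)
        \<longleftrightarrow> (partials is u \<longlongrightarrow> Up is x) (at x within pos)"
      by (rule Lim_cong_within) (use Up(2) that in simp_all)
    ultimately show ?thesis
      using plus_value_eq[OF that(2) True] \<Gamma>[OF that(2)] True by (simp add: plus_ext_def)
  next
    case False
    then show ?thesis
      using that \<Gamma>[OF that(2)] Up(2)[of "is" x] by (simp add: plus_ext_def pos_def)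
  qed
  have trace_neg: "plus_ext \<Gamma> \<phi> (partials is u) x = Um is x"
    if "length is \<le> q" "x \<in> B" "\<phi> x < 0" for "is" x
    using that \<Gamma>[OF that(2)] Um(2)[of "is" x] by (simp add: plus_ext_def neg_def)
  have w: "w x = glue P Um [] x" if "x \<in> U" for x
    using trace[of "[]" x] trace_neg[of "[]" x] that U(3)
    by (auto simp: w_def glue_def P_def heaviside_def)
  have lipw: "(\<Lambda>u (length is) + \<Lambda>v (length is))-lipschitz_on U (glue P Um is)"
    if "length is \<le> q" for "is"
  proof (rule lipschitz_on_glue[OF U(2,3)])
    have v0: "0 \<le> \<Lambda>v (length is)" using lipv[OF that] lipschitz_on_nonneg by blast
    show "(\<Lambda>u (length is) + \<Lambda>v (length is))-lipschitz_on (U \<inter> nonneg) (P is)"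
      unfolding P_def
      by (intro lipschitz_on_diff lipschitz_on_subset[OF lipUp[OF that]]
          lipschitz_on_subset[OF lipv[OF that]]) (use sub in auto)
    show "(\<Lambda>u (length is) + \<Lambda>v (length is))-lipschitz_on (U \<inter> nonpos) (Um is)"
      using lipUm[OF that] by (rule lipschitz_on_mono) (use v0 in auto)
    show "P is x = Um is x" if "x \<in> B" "\<phi> x = 0" for x
      using agree \<open>length is \<le> q\<close> that by blast
  qed
  show "LC_with q (\<lambda>n. \<Lambda>u n + \<Lambda>v n) U w"
    by (rule jet_on_imp_LC_with[OF U(1) jetw w lipw])
  show "partials is w x = plus_ext \<Gamma> \<phi> (partials is u) x"
    if "length is \<le> q" "x \<in> U" "\<phi> x < 0" for "is" x
    using jet_on_partials_eq[OF U(1) jetw w that(1,2)] trace_neg[OF that(1) _ that(3)] that U(3)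
    by (auto simp: glue_def)
  have jetwv: "jet_on q U (\<lambda>is y. glue P Um is y + partials is v y)"
    by (rule jet_on_add[OF jetw jet_on_subset[OF jetv U(3)]])
  have wv: "w x + v x = glue P Um [] x + partials [] v x" if "x \<in> U" for x
    using w[OF that] by simp
  show "LC_with q (\<lambda>n. \<Lambda>u n + \<Lambda>v n + \<Lambda>v n) U (\<lambda>x. w x + v x)"
  proof (rule jet_on_imp_LC_with[OF U(1) jetwv wv])
    show "(\<Lambda>u (length is) + \<Lambda>v (length is) + \<Lambda>v (length is))-lipschitz_on U
        (\<lambda>y. glue P Um is y + partials is v y)" if "length is \<le> q" for "is"
      by (rule lipschitz_on_add[OF lipw[OF that] lipschitz_on_subset[OF lipv[OF that] U(3)]])
  qed
  show "partials is (\<lambda>x. w x + v x) x = plus_ext \<Gamma> \<phi> (partials is u) x"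
    if "length is \<le> q" "x \<in> U" "\<phi> x \<ge> 0" for "is" x
    using jet_on_partials_eq[OF U(1) jetwv wv that(1,2)] trace[OF that(1) _ that(3)] that U(3)
    by (auto simp: glue_def P_def)
qed

end

section \<open>Consistency of the corrected difference scheme\<close>

lemma convex_neighbourhood:
  fixes K :: "'a::euclidean_space set"
  assumes "compact K" "convex K" "open A" "K \<subseteq> A"
  obtains U where "open U" "convex U" "K \<subseteq> U" "U \<subseteq> A"
proof -
  obtain e where e: "e > 0" "(\<Union>x\<in>K. ball x e) \<subseteq> A"
    using compact_subset_open_imp_ball_epsilon_subset assms(1,3,4) by metis
  have "(\<Union>x\<in>K. ball x e) = (\<Union>x\<in>K. \<Union>y\<in>ball 0 e. {x + y})"
  proof (intro equalityI subsetI)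
    fix z assume "z \<in> (\<Union>x\<in>K. ball x e)"
    then obtain x where "x \<in> K" "z \<in> ball x e" by blast
    moreover from this have "z - x \<in> ball 0 e" by (simp add: dist_norm norm_minus_commute)
    moreover have "z = x + (z - x)" by simp
    ultimately show "z \<in> (\<Union>x\<in>K. \<Union>y\<in>ball 0 e. {x + y})" by blast
  next
    fix z assume "z \<in> (\<Union>x\<in>K. \<Union>y\<in>ball 0 e. {x + y})"
    then obtain x y where "x \<in> K" "norm y < e" "z = x + y" by auto
    then show "z \<in> (\<Union>x\<in>K. ball x e)" by (intro UN_I[of x]) (auto simp: dist_norm)
  qed
  then have "convex (\<Union>x\<in>K. ball x e)"
    using convex_sums[OF assms(2) convex_ball[of 0 e]] by simp
  moreover have "K \<subseteq> (\<Union>x\<in>K. ball x e)" using e(1) by auto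
  ultimately show thesis using that[of "\<Union>x\<in>K. ball x e"] e(2) by blast
qed

lemma diff_op_cong:
  "(\<And>is. length is \<le> m \<Longrightarrow> F is x = G is x) \<Longrightarrow> diff_op m a F x = diff_op m a G x"
  unfolding diff_op_def by (rule sum.cong) auto

lemma fd_op_cong:
  "(\<And>x. x \<in> stencil S h j \<Longrightarrow> f x = g x) \<Longrightarrow> fd_op S c h f j = fd_op S c h g j"
  unfolding fd_op_def stencil_def by (rule sum.cong) auto

lemma fd_op_add: "fd_op S c h (\<lambda>x. f x + g x) j = fd_op S c h f j + fd_op S c h g j"
  by (simp add: fd_op_def distrib_left sum.distrib)

lemma fd_op_diff: "fd_op S c h (\<lambda>x. f x - g x) j = fd_op S c h f j - fd_op S c h g j"
  by (simp add: fd_op_def right_diff_distrib sum_subtractf)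

theorem proposition1:
  fixes \<Omega> \<Gamma> R :: "(real^'d::finite) set"
    and \<phi> :: "real^'d \<Rightarrow> real"
    and p q m :: nat
    and a :: "'d list \<Rightarrow> real^'d \<Rightarrow> real"
    and S :: "real \<Rightarrow> int^'d \<Rightarrow> (int^'d) set"
    and c :: "real \<Rightarrow> int^'d \<Rightarrow> int^'d \<Rightarrow> real"
    and h0 :: real
    and \<epsilon> :: "real \<Rightarrow> real"
  assumes domain: "open \<Omega>" "connected \<Omega>"
    and interface: "smooth_closed_hypersurface \<Gamma>" "\<Gamma> \<subseteq> \<Omega>" "bounds_region \<Gamma> R"
    and phi: "\<phi> = signed_dist \<Gamma> R"
    and order: "m \<le> q"
    and h0: "h0 > 0"
    and scheme: "fd_stencils \<Omega> S h0" "consistent p q \<Omega> m a S c h0"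
    and band_width: "\<epsilon> \<in> O[at_right 0](\<lambda>h. h)"
    and band: "\<forall>h\<in>{0<..<h0}. admissible_band \<Omega> \<Gamma> \<phi> S h (\<epsilon> h)"
  shows "\<forall>\<Lambda>u \<Lambda>v. \<exists>C. \<forall>u g.
      u \<in> LC2 q (inner_part \<Omega> R) (outer_part \<Omega> R) \<and>
      LC_with q \<Lambda>u (inner_part \<Omega> R) u \<and> LC_with q \<Lambda>u (outer_part \<Omega> R) u \<and>
      (\<forall>i\<le>q. g i \<in> LC_surface (q - i) \<Gamma>) \<and>
      (\<forall>i\<le>q. \<forall>x\<in>\<Gamma>. jump \<phi> ((normal_deriv \<phi> ^^ i) u) x = g i x) \<longrightarrow>
      (\<forall>h\<in>{0<..<h0}. \<forall>v.
        v \<in> LC q (band \<Omega> \<phi> (\<epsilon> h)) \<and> LC_with q \<Lambda>v (band \<Omega> \<phi> (\<epsilon> h)) v \<and>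
        (\<forall>i\<le>q. \<forall>x\<in>\<Gamma>. (normal_deriv \<phi> ^^ i) v x = g i x) \<longrightarrow>
        (\<forall>j\<in>grid \<Omega> S h.
          \<bar>diff_op m a (\<lambda>is. plus_ext \<Gamma> \<phi> (partials is u)) (grid_point h j)
            - (fd_op S c h (plus_ext \<Gamma> \<phi> u) j + correction \<Gamma> \<phi> S c h v j)\<bar> \<le> C * h ^ p))"
proof (intro allI)
  fix \<Lambda>u \<Lambda>v :: "nat \<Rightarrow> real"
  have R: "open R" "frontier R = \<Gamma>" using interface(3) by (auto simp: bounds_region_def)
  have \<Gamma>: "\<Gamma> \<noteq> {}" using interface(1) by (simp add: smooth_closed_hypersurface_def)
  note sign = signed_dist_sign[OF interface(3) \<Gamma>, folded phi]
  have clR: "closure R = R \<union> \<Gamma>" using R closure_Un_frontier by blast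
  have cons: "\<exists>C. \<forall>h\<in>{0<..<h0}. \<forall>j\<in>grid \<Omega> S h. \<forall>U w.
        open U \<and> convex U \<and> stencil S h j \<subseteq> U \<and> LC_with q \<Lambda> U w \<longrightarrow>
        \<bar>diff_op m a (\<lambda>is. partials is w) (grid_point h j) - fd_op S c h w j\<bar> \<le> C * h ^ p" for \<Lambda>
    using scheme(2) unfolding consistent_def by blast
  obtain C1 where C1: "\<And>h j U w. h \<in> {0<..<h0} \<Longrightarrow> j \<in> grid \<Omega> S h \<Longrightarrow> open U \<Longrightarrow> convex U \<Longrightarrow>
      stencil S h j \<subseteq> U \<Longrightarrow> LC_with q \<Lambda>u U w \<Longrightarrow>
      \<bar>diff_op m a (\<lambda>is. partials is w) (grid_point h j) - fd_op S c h w j\<bar> \<le> C1 * h ^ p"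
    using cons[of \<Lambda>u] by blast
  obtain C2 where C2: "\<And>h j U w. h \<in> {0<..<h0} \<Longrightarrow> j \<in> grid \<Omega> S h \<Longrightarrow> open U \<Longrightarrow> convex U \<Longrightarrow>
      stencil S h j \<subseteq> U \<Longrightarrow> LC_with q (\<lambda>n. \<Lambda>u n + \<Lambda>v n) U w \<Longrightarrow>
      \<bar>diff_op m a (\<lambda>is. partials is w) (grid_point h j) - fd_op S c h w j\<bar> \<le> C2 * h ^ p"
    using cons[of "\<lambda>n. \<Lambda>u n + \<Lambda>v n"] by blast
  obtain C3 where C3: "\<And>h j U w. h \<in> {0<..<h0} \<Longrightarrow> j \<in> grid \<Omega> S h \<Longrightarrow> open U \<Longrightarrow> convex U \<Longrightarrow>
      stencil S h j \<subseteq> U \<Longrightarrow> LC_with q (\<lambda>n. \<Lambda>u n + \<Lambda>v n + \<Lambda>v n) U w \<Longrightarrow>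
      \<bar>diff_op m a (\<lambda>is. partials is w) (grid_point h j) - fd_op S c h w j\<bar> \<le> C3 * h ^ p"
    using cons[of "\<lambda>n. \<Lambda>u n + \<Lambda>v n + \<Lambda>v n"] by blast
  define C where "C = max C1 (max C2 C3)"
  show "\<exists>C. \<forall>u g.
      u \<in> LC2 q (inner_part \<Omega> R) (outer_part \<Omega> R) \<and>
      LC_with q \<Lambda>u (inner_part \<Omega> R) u \<and> LC_with q \<Lambda>u (outer_part \<Omega> R) u \<and>
      (\<forall>i\<le>q. g i \<in> LC_surface (q - i) \<Gamma>) \<and>
      (\<forall>i\<le>q. \<forall>x\<in>\<Gamma>. jump \<phi> ((normal_deriv \<phi> ^^ i) u) x = g i x) \<longrightarrow>
      (\<forall>h\<in>{0<..<h0}. \<forall>v.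
        v \<in> LC q (band \<Omega> \<phi> (\<epsilon> h)) \<and> LC_with q \<Lambda>v (band \<Omega> \<phi> (\<epsilon> h)) v \<and>
        (\<forall>i\<le>q. \<forall>x\<in>\<Gamma>. (normal_deriv \<phi> ^^ i) v x = g i x) \<longrightarrow>
        (\<forall>j\<in>grid \<Omega> S h.
          \<bar>diff_op m a (\<lambda>is. plus_ext \<Gamma> \<phi> (partials is u)) (grid_point h j)
            - (fd_op S c h (plus_ext \<Gamma> \<phi> u) j + correction \<Gamma> \<phi> S c h v j)\<bar> \<le> C * h ^ p))"
  proof (rule exI[of _ C], intro allI impI ballI, elim conjE)
    fix u g h v j
    assume u: "LC_with q \<Lambda>u (inner_part \<Omega> R) u" "LC_with q \<Lambda>u (outer_part \<Omega> R) u"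
      and gu: "\<forall>i\<le>q. \<forall>x\<in>\<Gamma>. jump \<phi> ((normal_deriv \<phi> ^^ i) u) x = g i x"
      and h: "h \<in> {0<..<h0}"
      and v: "LC_with q \<Lambda>v (band \<Omega> \<phi> (\<epsilon> h)) v"
      and gv: "\<forall>i\<le>q. \<forall>x\<in>\<Gamma>. (normal_deriv \<phi> ^^ i) v x = g i x"
      and j: "j \<in> grid \<Omega> S h"
    have hp: "C1 * h ^ p \<le> C * h ^ p" "C2 * h ^ p \<le> C * h ^ p" "C3 * h ^ p \<le> C * h ^ p"
      using h by (auto simp: C_def intro!: mult_right_mono)
    define K where "K = convex hull (stencil S h j)"
    define xj where "xj = grid_point h j"
    have "finite (stencil S h j)"
      using scheme(1) h j by (auto simp: fd_stencils_def stencil_def)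
    then have K: "compact K" "convex K"
      by (simp_all add: K_def finite_imp_compact_convex_hull convex_convex_hull)
    have stK: "stencil S h j \<subseteq> K" by (simp add: K_def hull_subset)
    have xjK: "xj \<in> K" using scheme(1) h j by (auto simp: fd_stencils_def K_def xj_def)
    have K\<Omega>: "K \<subseteq> \<Omega>" using j by (simp add: grid_def K_def)
    let ?w = "\<lambda>x. plus_ext \<Gamma> \<phi> u x - v x * heaviside (\<phi> x)"
    show "\<bar>diff_op m a (\<lambda>is. plus_ext \<Gamma> \<phi> (partials is u)) (grid_point h j)
            - (fd_op S c h (plus_ext \<Gamma> \<phi> u) j + correction \<Gamma> \<phi> S c h v j)\<bar> \<le> C * h ^ p"
    proof (cases "crosses \<Gamma> S h j")
      case False
      then have K\<Gamma>: "K \<inter> \<Gamma> = {}" by (simp add: crosses_def K_def)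
      obtain A where A: "open A" "K \<subseteq> A" "LC_with q \<Lambda>u A u"
      proof (cases "K \<inter> R = {}")
        case True
        then have "K \<subseteq> outer_part \<Omega> R" using K\<Omega> K\<Gamma> clR by (auto simp: outer_part_def)
        moreover have "open (outer_part \<Omega> R)" using domain(1) by (simp add: outer_part_def open_Diff)
        ultimately show thesis using that u(2) by blast
      next
        case False
        have "K - R = {}"
          using connected_Int_frontier[OF convex_connected[OF K(2)] False] K\<Gamma> R(2) by blast
        then have "K \<subseteq> inner_part \<Omega> R" using K\<Omega> by (auto simp: inner_part_def)
        moreover have "open (inner_part \<Omega> R)" using domain(1) R(1) by (simp add: inner_part_def open_Int)
        ultimately show thesis using that u(1) by blast
      qed
      obtain U where U: "open U" "convex U" "K \<subseteq> U" "U \<subseteq> A"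
        using convex_neighbourhood[OF K A(1,2)] by blast
      have "\<bar>diff_op m a (\<lambda>is. partials is u) xj - fd_op S c h u j\<bar> \<le> C1 * h ^ p"
        unfolding xj_def using C1[OF h j U(1,2)] stK U(3) LC_with_subset[OF A(3) U(4)] by blast
      moreover have "diff_op m a (\<lambda>is. plus_ext \<Gamma> \<phi> (partials is u)) xj = diff_op m a (\<lambda>is. partials is u) xj"
        by (rule diff_op_cong) (use xjK K\<Gamma> in \<open>auto simp: plus_ext_def\<close>)
      moreover have "fd_op S c h (plus_ext \<Gamma> \<phi> u) j = fd_op S c h u j"
        by (rule fd_op_cong) (use stK K\<Gamma> in \<open>auto simp: plus_ext_def\<close>)
      ultimately show ?thesis using False hp(1) by (simp add: correction_def xj_def)
    next
      case True
      define B where "B = band \<Omega> \<phi> (\<epsilon> h)"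
      have adm: "admissible_band \<Omega> \<Gamma> \<phi> S h (\<epsilon> h)" using band h by blast
      have KB: "K \<subseteq> B" using adm j True by (simp add: admissible_band_def K_def B_def)
      have B: "open B" "smooth_on B \<phi>"
      proof -
        have "B = \<Omega> \<inter> {x. infdist x \<Gamma> < \<epsilon> h}" by (auto simp: B_def band_def sign(4))
        moreover have "open {x. infdist x \<Gamma> < \<epsilon> h}"
          by (intro open_Collect_less continuous_intros)
        ultimately show "open B" using domain(1) by auto
        show "smooth_on B \<phi>" using adm by (simp add: admissible_band_def B_def)
      qed
      have grad_nz: "grad \<phi> x \<noteq> 0" if "x \<in> B" "\<phi> x = 0" for x
        using grad_signed_dist_nonzero[OF interface(3) \<Gamma> B(1), folded phi, OF B(2) that(1)]
          that(2) sign(2)[of x] by simp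
      interpret regular_level_set B \<phi>
        by (rule regular_level_set.intro[OF B grad_nz])
      have B\<Omega>: "x \<in> \<Omega>" if "x \<in> B" for x using that by (simp add: B_def band_def)
      have "pos \<subseteq> inner_part \<Omega> R" "neg \<subseteq> outer_part \<Omega> R"
        unfolding pos_def neg_def inner_part_def outer_part_def sign(1,3) using B\<Omega> by blast+
      then have upos: "LC_with q \<Lambda>u pos u" and uneg: "LC_with q \<Lambda>u neg u"
        using LC_with_subset u by blast+
      obtain U where U: "open U" "convex U" "K \<subseteq> U" "U \<subseteq> B"
        using convex_neighbourhood[OF K B(1) KB] by blast
      have jmp: "jump \<phi> ((normal_deriv \<phi> ^^ k) u) x = (normal_deriv \<phi> ^^ k) v x"
        if "k \<le> q" "x \<in> B" "\<phi> x = 0" for k x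
        using gu gv that sign(2) by simp
      have \<Gamma>iff: "x \<in> \<Gamma> \<longleftrightarrow> \<phi> x = 0" for x using sign(2) by blast
      note removal = jump_removal[OF upos uneg v[folded B_def] jmp \<Gamma>iff U(1,2,4)]
      have w: "LC_with q (\<lambda>n. \<Lambda>u n + \<Lambda>v n) U ?w"
        by (rule removal(1))
      have wv: "LC_with q (\<lambda>n. \<Lambda>u n + \<Lambda>v n + \<Lambda>v n) U (\<lambda>x. ?w x + v x)"
        by (rule removal(2))
      have partials_w: "partials is ?w x = plus_ext \<Gamma> \<phi> (partials is u) x"
        if "length is \<le> q" "x \<in> U" "\<phi> x < 0" for "is" x
        using that by (intro removal(3))
      have partials_wv: "partials is (\<lambda>x. ?w x + v x) x = plus_ext \<Gamma> \<phi> (partials is u) x"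
        if "length is \<le> q" "x \<in> U" "\<phi> x \<ge> 0" for "is" x
        using that by (intro removal(4))
      have stU: "stencil S h j \<subseteq> U" and xjU: "xj \<in> U" using stK U(3) xjK by auto
      show ?thesis
      proof (cases "\<phi> xj < 0")
        case neg: True
        have "diff_op m a (\<lambda>is. plus_ext \<Gamma> \<phi> (partials is u)) xj = diff_op m a (\<lambda>is. partials is ?w) xj"
          by (rule diff_op_cong) (simp add: partials_w[OF _ xjU neg] order_trans[OF _ order])
        moreover have "fd_op S c h (plus_ext \<Gamma> \<phi> u) j + correction \<Gamma> \<phi> S c h v j = fd_op S c h ?w j"
          using True neg by (simp add: correction_def fd_op_diff heaviside_def xj_def)
        ultimately show ?thesis
          using C2[OF h j U(1,2) stU w] hp(2) by (simp add: xj_def)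
      next
        case nonneg: False
        have "diff_op m a (\<lambda>is. plus_ext \<Gamma> \<phi> (partials is u)) xj
            = diff_op m a (\<lambda>is. partials is (\<lambda>x. ?w x + v x)) xj"
          by (rule diff_op_cong) (use nonneg order in \<open>simp add: partials_wv[OF _ xjU]\<close>)
        moreover have "fd_op S c h (plus_ext \<Gamma> \<phi> u) j + correction \<Gamma> \<phi> S c h v j
            = fd_op S c h (\<lambda>x. ?w x + v x) j"
          using True nonneg unfolding fd_op_add fd_op_diff
          by (simp add: correction_def heaviside_def xj_def)
        ultimately show ?thesis
          using C3[OF h j U(1,2) stU wv] hp(3) by (simp add: xj_def)
      qed
    qed
  qed
qed

end
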